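(* Let $k\ge1$ and $0\le b_0\le k$ be integers. Then, as formal power series in $q,z$, $$\chi_{k,3;(b_0,k)}(q,z)=\sum_{n=0}^\infty\ \sum_{\substack{l_1,l_2\ge0\\ l_1+l_2=n}}\ \sum_{\substack{m_{i,j}\ge 0\\ \sum_{j=1}^k jm_{i,j}=l_i\ (i=1,2)}}\frac{q^{{}^t\mathbf mA\mathbf m-(\operatorname{diag}A)\cdot\mathbf m+2\mathbf c^{(3)}_{b_0}\cdot\mathbf m}}{(q^2)_{m_{1,1}}\cdots(q^2)_{m_{1,k}}(q^2)_{m_{2,1}}\cdots(q^2)_{m_{2,k}}}\,q^{l_2}z^n,$$ where $\mathbf m={}^t(m_{1,1},\dots,m_{1,k},m_{2,1},\dots,m_{2,k})$; $A$ is the $2k\times2k$ matrix $$A=\begin{pmatrix}A^{(2)}&B^{(3)}\\ B^{(3)}&A^{(2)}\end{pmatrix},\qquad A^{(2)}_{ab}=2\min(a,b),\quad B^{(3)}_{ab}=\max(0,a+b-k)\quad(1\le a,b\le k);$$ $\operatorname{diag}A$ is the vector of diagonal entries of $A$; and $\mathbf c^{(3)}_{b_0}\in\mathbb Z^{2k}$ is the vector whose first $k$ entries are $0,\dots,0,1,2,\dots,k-b_0$ (the $a$-th being $\max(a-b_0,0)$) and whose last $k$ entries are $0$.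
   Context: A sequence $\mathbf a=(a_i)_{i\ge0}$ of integers with finitely many non-zero entries is $(k,3)$-admissible if $0\le a_i\le k$ and $a_i+a_{i+1}+a_{i+2}\le k$ for all $i\ge0$. For $0\le b_0\le b_1\le k$ let $C^{(k,3)}_{(b_0,b_1)}$ be the set of $(k,3)$-admissible sequences with $a_0\le b_0$ and $a_0+a_1\le b_1$ (for $b_1=k$ the second condition is automatic). The character of $(k,3)$-admissible configurations is $$\chi_{k,3;(b_0,b_1)}(q,z)=\sum_{\mathbf a\in C^{(k,3)}_{(b_0,b_1)}}q^{\sum_{j\ge0}ja_j}z^{\sum_{j\ge0}a_j}.$$ Also $(q^2)_m=\prod_{j=1}^m(1-q^{2j})$. *)

theory Defs
  imports
    "Jordan_Normal_Form.Matrix"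
    "HOL-Computational_Algebra.Formal_Power_Series"
begin

no_notation fps_nth (infixl \<open>$\<close> 75)

section \<open>Admissible configurations and their character\<close>

text \<open>An integer sequence with \<open>0 \<le> a i\<close> for all \<open>i\<close> is represented by a function into \<open>nat\<close>.\<close>

definition admissible3 :: "nat \<Rightarrow> (nat \<Rightarrow> nat) \<Rightarrow> bool" where
  "admissible3 k a \<longleftrightarrow>
     finite {i. a i \<noteq> 0} \<and> (\<forall>i. a i \<le> k) \<and> (\<forall>i. a i + a (i + 1) + a (i + 2) \<le> k)"

definition C3 :: "nat \<Rightarrow> nat \<Rightarrow> nat \<Rightarrow> (nat \<Rightarrow> nat) set" where
  "C3 k b0 b1 = {a. admissible3 k a \<and> a 0 \<le> b0 \<and> a 0 + a 1 \<le> b1}"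

definition weight :: "(nat \<Rightarrow> nat) \<Rightarrow> nat" where
  "weight a = (\<Sum>j | a j \<noteq> 0. j * a j)"

definition charge :: "(nat \<Rightarrow> nat) \<Rightarrow> nat" where
  "charge a = (\<Sum>j | a j \<noteq> 0. a j)"

text \<open>
  Formal power series in \<open>q, z\<close> are elements of \<^typ>\<open>rat fps fps\<close>: the outer variable is \<open>z\<close>,
  the inner one is \<open>q\<close>. The character is an infinite sum in which infinitely many terms share the
  same power of \<open>z\<close>, so it does not converge in the library's topology on \<^typ>\<open>rat fps fps\<close> (which
  treats the coefficients in \<^typ>\<open>rat fps\<close> as discrete). It is taken monomial by monomial instead;
  this is meaningful for families with finitely many contributions to each monomial, see
  \<open>finite_C3_weight_charge\<close> below.
\<close>

abbreviation q :: "rat fps" where "q \<equiv> fps_X"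

abbreviation z :: "rat fps fps" where "z \<equiv> fps_X"

definition formal_sum :: "('i \<Rightarrow> rat fps fps) \<Rightarrow> 'i set \<Rightarrow> rat fps fps" where
  "formal_sum f I = Abs_fps (\<lambda>n. Abs_fps (\<lambda>d.
     \<Sum>i | i \<in> I \<and> fps_nth (fps_nth (f i) n) d \<noteq> 0. fps_nth (fps_nth (f i) n) d))"

definition chi3 :: "nat \<Rightarrow> nat \<Rightarrow> nat \<Rightarrow> rat fps fps" where
  "chi3 k b0 b1 = formal_sum (\<lambda>a. fps_const (q ^ weight a) * z ^ charge a) (C3 k b0 b1)"

lemma finite_C3_weight_charge: "finite {a \<in> C3 k b0 b1. weight a = d \<and> charge a = n}"
proof (rule finite_subset)
  let ?S = "{a. \<forall>i. (i \<in> {..d} \<longrightarrow> a i \<in> {..k}) \<and> (i \<notin> {..d} \<longrightarrow> a i = (0::nat))}"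
  show "finite ?S"
    by (rule finite_set_of_finite_funs) auto
  show "{a \<in> C3 k b0 b1. weight a = d \<and> charge a = n} \<subseteq> ?S"
  proof (intro subsetI CollectI allI conjI impI)
    fix a i
    assume "a \<in> {a \<in> C3 k b0 b1. weight a = d \<and> charge a = n}"
    then have a: "a \<in> C3 k b0 b1" and d: "weight a = d"
      by auto
    from a show "a i \<in> {..k}"
      by (simp add: C3_def admissible3_def)
    assume i: "i \<notin> {..d}"
    show "a i = 0"
    proof (rule ccontr)
      assume nz: "a i \<noteq> 0"
      from a have "finite {j. a j \<noteq> 0}"
        by (simp add: C3_def admissible3_def)
      with nz have "i * a i \<le> weight a"
        unfolding weight_def by (intro member_le_sum) auto
      moreover from nz have "i \<le> i * a i"
        by simp
      ultimately show False
        using i d by (metis atMost_iff le_trans)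
    qed
  qed
qed

lemma chi3_nth:
  "fps_nth (fps_nth (chi3 k b0 b1) n) d =
     of_nat (card {a \<in> C3 k b0 b1. weight a = d \<and> charge a = n})"
proof -
  have *: "fps_nth (fps_nth (fps_const (q ^ w) * z ^ c) n) d = (if w = d \<and> c = n then 1 else 0)"
    for w c
    by (auto simp: fps_X_power_iff)
  have "{a. a \<in> C3 k b0 b1 \<and>
            fps_nth (fps_nth (fps_const (q ^ weight a) * z ^ charge a) n) d \<noteq> 0} =
        {a \<in> C3 k b0 b1. weight a = d \<and> charge a = n}"
    by (auto simp: * split: if_splits)
  then show ?thesis
    by (simp add: chi3_def formal_sum_def *)
qed

section \<open>The fermionic side\<close>

definition q2_poch :: "nat \<Rightarrow> rat fps" where
  "q2_poch m = (\<Prod>j=1..m. 1 - q ^ (2 * j))"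

text \<open>
  Vectors and matrices are indexed from 0, so position \<open>a\<close> holds the entry with 1-based index
  \<open>a + 1\<close>.
\<close>

definition A2 :: "nat \<Rightarrow> int mat" where
  "A2 k = mat k k (\<lambda>(a, b). 2 * min (int (a + 1)) (int (b + 1)))"

definition B3 :: "nat \<Rightarrow> int mat" where
  "B3 k = mat k k (\<lambda>(a, b). max 0 (int (a + 1) + int (b + 1) - int k))"

definition A_mat :: "nat \<Rightarrow> int mat" where
  "A_mat k = four_block_mat (A2 k) (B3 k) (B3 k) (A2 k)"

definition c3 :: "nat \<Rightarrow> nat \<Rightarrow> int vec" where
  "c3 k b0 = vec k (\<lambda>a. max (int (a + 1) - int b0) 0) @\<^sub>v 0\<^sub>v k"

definition exponent :: "nat \<Rightarrow> nat \<Rightarrow> nat vec \<Rightarrow> nat vec \<Rightarrow> int" where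
  "exponent k b0 m1 m2 =
     (let m = map_vec int (m1 @\<^sub>v m2)
      in m \<bullet> (A_mat k *\<^sub>v m) - vec_of_list (diag_mat (A_mat k)) \<bullet> m + 2 * (c3 k b0 \<bullet> m))"

definition multiplicities :: "nat \<Rightarrow> nat \<Rightarrow> nat vec set" where
  "multiplicities k l = {m \<in> carrier_vec k. (\<Sum>j=1..k. j * m $ (j - 1)) = l}"

lemma finite_multiplicities: "finite (multiplicities k l)"
proof (rule finite_subset)
  let ?F = "{f. \<forall>i. (i \<in> {..<k} \<longrightarrow> f i \<in> {..l}) \<and> (i \<notin> {..<k} \<longrightarrow> f i = (0::nat))}"
  show "finite (vec k ` ?F)"
    by (intro finite_imageI finite_set_of_finite_funs) auto
  show "multiplicities k l \<subseteq> vec k ` ?F"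
  proof
    fix m
    assume m: "m \<in> multiplicities k l"
    have le: "m $ i \<le> l" if "i < k" for i
    proof -
      have "m $ i \<le> (i + 1) * m $ (i + 1 - 1)"
        by simp
      also have "\<dots> \<le> (\<Sum>j=1..k. j * m $ (j - 1))"
        using that by (intro member_le_sum) auto
      finally show ?thesis
        using m by (simp add: multiplicities_def)
    qed
    have "m = vec k (\<lambda>i. if i < k then m $ i else 0)"
      using m by (intro eq_vecI) (auto simp: multiplicities_def)
    moreover have "(\<lambda>i. if i < k then m $ i else 0) \<in> ?F"
      using le by auto
    ultimately show "m \<in> vec k ` ?F"
      by (rule image_eqI)
  qed
qed

text \<open>
  The power of \<open>q\<close> in the theorem is \<open>nat (exponent k b0 m1 m2)\<close>; by the following lemma no
  truncation takes place.
\<close>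

lemma exponent_nonneg:
  assumes "m1 \<in> carrier_vec k" "m2 \<in> carrier_vec k"
  shows "exponent k b0 m1 m2 \<ge> 0"
proof -
  define m where "m = map_vec int (m1 @\<^sub>v m2)"
  define A where "A = A_mat k"
  have dims: "dim_vec m = k + k" "dim_row A = k + k" "dim_col A = k + k" "dim_vec (c3 k b0) = k + k"
    using assms by (auto simp: m_def A_def A_mat_def A2_def c3_def)
  have A_nonneg: "A $$ (i, j) \<ge> 0" if "i < k + k" "j < k + k" for i j
    using that by (auto simp: A_def A_mat_def A2_def B3_def)
  have m_nonneg: "m $ i \<ge> 0" if "i < k + k" for i
    using that assms by (auto simp: m_def)
  have c_nonneg: "c3 k b0 $ i \<ge> 0" if "i < k + k" for i
    using that by (auto simp: c3_def)
  have diag: "vec_of_list (diag_mat A) \<bullet> m = (\<Sum>i<k + k. A $$ (i, i) * m $ i)"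
    using dims
    by (auto simp: scalar_prod_def diag_mat_def vec_of_list_index atLeast0LessThan
        intro!: sum.cong)
  have quad: "m \<bullet> (A *\<^sub>v m) = (\<Sum>i<k + k. m $ i * (\<Sum>j<k + k. A $$ (i, j) * m $ j))"
    using dims by (auto simp: scalar_prod_def atLeast0LessThan intro!: sum.cong)
  have "A $$ (i, i) * m $ i \<le> m $ i * (\<Sum>j<k + k. A $$ (i, j) * m $ j)" if i: "i < k + k" for i
  proof -
    have "A $$ (i, i) * m $ i \<le> A $$ (i, i) * (m $ i * m $ i)"
    proof (rule mult_left_mono)
      show "m $ i \<le> m $ i * m $ i"
        using m_nonneg[OF i] by (cases "m $ i = 0") (auto simp: mult_le_cancel_left1)
    qed (use A_nonneg i in auto)
    also have "\<dots> = m $ i * (A $$ (i, i) * m $ i)"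
      by simp
    also have "\<dots> \<le> m $ i * (\<Sum>j<k + k. A $$ (i, j) * m $ j)"
      using i by (intro mult_left_mono member_le_sum[where f = "\<lambda>j. A $$ (i, j) * m $ j"])
        (auto intro!: mult_nonneg_nonneg A_nonneg m_nonneg)
    finally show ?thesis .
  qed
  then have "vec_of_list (diag_mat A) \<bullet> m \<le> m \<bullet> (A *\<^sub>v m)"
    unfolding diag quad by (intro sum_mono) auto
  moreover have "c3 k b0 \<bullet> m \<ge> 0"
    using dims by (auto simp: scalar_prod_def intro!: sum_nonneg mult_nonneg_nonneg c_nonneg m_nonneg)
  ultimately show ?thesis
    by (simp add: exponent_def Let_def m_def A_def)
qed

end

theory Submission
  imports Defs "HOL-Library.Function_Algebras"
begin

text \<open>
  Let \<open>X(p, b, r)\<close> be the character of \<open>C\<^bsub>(p, p + b)\<^esub>\<close> with \<open>k = p + b + r\<close>. Splitting off \<open>a\<^sub>0\<close>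
  shows that the family \<open>X\<close> is determined by
  \<open>X(p, b, r)(z) - X(p - 1, b + 1, r)(z) = z\<^sup>p X(b, r, p)(q z)\<close> for \<open>p \<ge> 1\<close>, and
  \<open>X(0, b, r)(z) = X(b, r, 0)(q z)\<close>. The fermionic side has to be embedded into a family with the same
  recursion.

  With \<open>N\<^sub>i = m\<^bsub>1,i\<^esub> + \<dots> + m\<^bsub>1,k\<^esub>\<close> and \<open>M\<^sub>i = m\<^bsub>2,i\<^esub> + \<dots> + m\<^bsub>2,k\<^esub>\<close>, the quadratic form is
  \<open>2 \<Sum> (N\<^sub>i\<^sup>2 + M\<^sub>i\<^sup>2 + N\<^sub>i M\<^bsub>k+1-i\<^esub>)\<close>: an even cluster of size \<open>j\<close> occupies the first \<open>j\<close> of \<open>k\<close>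
  colours, an odd one the last \<open>j\<close>. So the fermionic sum is a matrix element \<open>L w \<rho>\<close> of a word \<open>w\<close> of
  \<open>k\<close> transfer operators, one for each colour: \<open>L a\<^bsup>b0\<^esup> y\<^bsup>k-b0\<^esup> \<rho>\<close>, where \<open>a\<close>, \<open>y\<close>, \<open>c\<close>, \<open>d / z\<close> belong to
  the level one configurations starting at position 0, 1, 2, 3. If \<open>E\<close> is the shift of \<open>N\<close> and
  \<open>e = 1 - E\<close>, then \<open>y a = a e y\<close>, \<open>d c = c e d\<close>, \<open>a E = E d\<close>, \<open>L E = L\<close> and \<open>v y \<rho> = v a e \<rho>\<close>.

  In the generating functions \<open>\<Pi> = (1 - \<xi>a - \<eta>c + \<xi>\<eta> a e c)\<^sup>-\<^sup>1 = \<Sum> P\<^bsub>p,r\<^esub> \<xi>\<^sup>p \<eta>\<^sup>r\<close>,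
  \<open>\<Pi>' = (1 - \<zeta>y - \<xi>d + \<xi>\<zeta> y e d)\<^sup>-\<^sup>1\<close>, \<open>K = (1 - \<zeta>y)\<^sup>-\<^sup>1\<close> and \<open>C = (1 - \<eta>c)\<^sup>-\<^sup>1\<close> these relations
  give \<open>K (1 - \<xi>a e) \<Pi>'\<^sup>-\<^sup>1 = (1 - \<xi>a) (1 - \<xi>e d)\<close> and
  \<open>\<Pi> (1 - \<xi>a) (1 - \<xi>e d) C\<^sup>-\<^sup>1 = 1 - \<xi>e d\<close>. Since \<open>L e = 0\<close>, it follows that
  \<open>L \<Pi> K (1 - \<xi>a e) = L C \<Pi>'\<close>. Applied to \<open>\<rho>\<close>, this is the recursion for \<open>X(p, b, r) = L P\<^bsub>p,r\<^esub> y\<^sup>b \<rho>\<close>,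
  because reversing the colours and exchanging the roles of \<open>N\<close> and \<open>M\<close> turns \<open>P\<^bsub>b,p\<^esub> y\<^sup>r\<close> into the
  coefficient of \<open>\<xi>\<^sup>p \<eta>\<^sup>r \<zeta>\<^sup>b\<close> in \<open>C \<Pi>'\<close>, up to the substitution \<open>z \<mapsto> q z\<close>.
\<close>

section \<open>An identity between noncommuting operators\<close>

text \<open>Coefficient of \<open>\<xi>^i \<eta>^j\<close> in
  \<open>v (1 - \<xi>A - \<eta>B + \<xi>\<eta>G)^-1\<close> for a row vector \<open>v\<close>; the
  recursion splits off the last factor.\<close>

fun delannoy_sum ::
  "('v \<Rightarrow> 'v) \<Rightarrow> ('v \<Rightarrow> 'v) \<Rightarrow> ('v \<Rightarrow> 'v) \<Rightarrow> 'v \<Rightarrow> nat \<Rightarrow> nat \<Rightarrow> 'v::ab_group_add" where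
  "delannoy_sum A B G v 0 0 = v"
| "delannoy_sum A B G v (Suc i) 0 = A (delannoy_sum A B G v i 0)"
| "delannoy_sum A B G v 0 (Suc j) = B (delannoy_sum A B G v 0 j)"
| "delannoy_sum A B G v (Suc i) (Suc j) =
     A (delannoy_sum A B G v i (Suc j)) + B (delannoy_sum A B G v (Suc i) j)
       - G (delannoy_sum A B G v i j)"

lemma delannoy_sum_0_left: "delannoy_sum A B G v 0 j = (B ^^ j) v"
  by (induction j) auto

lemma delannoy_sum_0_right: "delannoy_sum A B G v i 0 = (A ^^ i) v"
  by (induction i) auto

section \<open>Expansion over Delannoy paths\<close>

definition delannoy_paths :: "nat \<Rightarrow> nat \<Rightarrow> (nat \<times> nat) list set" where
  "delannoy_paths i j = {bs. set bs \<subseteq> {(1, 0), (0, 1), (1, 1)} \<and>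
     sum_list (map fst bs) = i \<and> sum_list (map snd bs) = j}"

lemma rev_delannoy_paths: "bs \<in> delannoy_paths i j \<Longrightarrow> rev bs \<in> delannoy_paths i j"
  by (simp add: delannoy_paths_def flip: rev_map)

lemma length_delannoy_path: "bs \<in> delannoy_paths i j \<Longrightarrow> length bs \<le> i + j"
proof -
  have "length bs \<le> sum_list (map fst bs) + sum_list (map snd bs)"
    if "set bs \<subseteq> {(1, 0), (0, 1), (1, 1)}" for bs :: "(nat \<times> nat) list"
    using that by (induction bs) auto
  then show "bs \<in> delannoy_paths i j \<Longrightarrow> length bs \<le> i + j"
    by (auto simp: delannoy_paths_def)
qed

lemma finite_delannoy_paths: "finite (delannoy_paths i j)"
proof (rule finite_subset)
  show "delannoy_paths i j \<subseteq>
      {bs. set bs \<subseteq> {(1, 0), (0, 1), (1, 1)} \<and> length bs \<le> i + j}"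
    using length_delannoy_path by (auto simp: delannoy_paths_def)
qed (auto intro: finite_lists_length_le)

lemma delannoy_paths_snoc:
  "delannoy_paths 0 0 = {[]}"
  "delannoy_paths (Suc i) 0 = (\<lambda>bs. bs @ [(1, 0)]) ` delannoy_paths i 0"
  "delannoy_paths 0 (Suc j) = (\<lambda>bs. bs @ [(0, 1)]) ` delannoy_paths 0 j"
  "delannoy_paths (Suc i) (Suc j) =
     (\<lambda>bs. bs @ [(1, 0)]) ` delannoy_paths i (Suc j) \<union>
     (\<lambda>bs. bs @ [(0, 1)]) ` delannoy_paths (Suc i) j \<union>
     (\<lambda>bs. bs @ [(1, 1)]) ` delannoy_paths i j"
proof -
  have snoc: "delannoy_paths i j = (if i = 0 \<and> j = 0 then {[]} else {}) \<union>
      (\<Union>x \<in> {(1, 0), (0, 1), (1, 1)} \<inter> {..i} \<times> {..j}.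
        (\<lambda>bs. bs @ [x]) ` delannoy_paths (i - fst x) (j - snd x))" (is "_ = ?E \<union> ?S") for i j
  proof (rule Set.set_eqI)
    fix bs
    show "bs \<in> delannoy_paths i j \<longleftrightarrow> bs \<in> ?E \<union> ?S"
      by (cases bs rule: rev_cases) (auto simp: delannoy_paths_def image_iff)
  qed
  show "delannoy_paths 0 0 = {[]}"
    by (subst snoc) auto
  show "delannoy_paths (Suc i) 0 = (\<lambda>bs. bs @ [(1, 0)]) ` delannoy_paths i 0"
    by (subst snoc) auto
  show "delannoy_paths 0 (Suc j) = (\<lambda>bs. bs @ [(0, 1)]) ` delannoy_paths 0 j"
    by (subst snoc) auto
  show "delannoy_paths (Suc i) (Suc j) =
     (\<lambda>bs. bs @ [(1, 0)]) ` delannoy_paths i (Suc j) \<union>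
     (\<lambda>bs. bs @ [(0, 1)]) ` delannoy_paths (Suc i) j \<union>
     (\<lambda>bs. bs @ [(1, 1)]) ` delannoy_paths i j"
    by (subst snoc) auto
qed

definition step_op :: "('v \<Rightarrow> 'v) \<Rightarrow> ('v \<Rightarrow> 'v) \<Rightarrow> ('v \<Rightarrow> 'v) \<Rightarrow> nat \<times> nat \<Rightarrow> 'v \<Rightarrow> 'v" where
  "step_op A B G x = (if x = (1, 0) then A else if x = (0, 1) then B else G)"

text \<open>A path from \<open>(0, 0)\<close> to \<open>(i, j)\<close> has \<open>i + j - length bs\<close> diagonal steps, each contributing
  a factor \<open>- 1\<close>.\<close>

lemma delannoy_sum_eq:
  fixes \<phi> :: "'v::ab_group_add \<Rightarrow> 'w::comm_ring_1"
  assumes "additive \<phi>" "additive A" "additive B" "additive G"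
  shows "\<phi> (delannoy_sum A B G v i j) =
    (\<Sum>bs \<in> delannoy_paths i j. (-1) ^ (i + j + length bs) * \<phi> (fold (step_op A B G) bs v))"
  using assms
proof (induction A B G v i j arbitrary: \<phi> rule: delannoy_sum.induct)
  case (1 A B G v)
  then show ?case by (simp add: delannoy_paths_snoc(1))
next
  case (2 A B G v i)
  have "additive (\<lambda>x. \<phi> (A x))"
    using 2 by (simp add: additive_def)
  from 2(1)[OF this] 2 show ?case
    by (simp add: delannoy_paths_snoc sum.reindex inj_on_def step_op_def)
next
  case (3 A B G v j)
  have "additive (\<lambda>x. \<phi> (B x))"
    using 3 by (simp add: additive_def)
  from 3(1)[OF this] 3 show ?case
    by (simp add: delannoy_paths_snoc sum.reindex inj_on_def step_op_def)
next
  case (4 A B G v i j)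
  have add: "additive (\<lambda>x. \<phi> (A x))" "additive (\<lambda>x. \<phi> (B x))" "additive (\<lambda>x. \<phi> (G x))"
    using 4 by (simp_all add: additive_def)
  have "\<phi> (delannoy_sum A B G v (Suc i) (Suc j)) = \<phi> (A (delannoy_sum A B G v i (Suc j)))
      + \<phi> (B (delannoy_sum A B G v (Suc i) j)) - \<phi> (G (delannoy_sum A B G v i j))"
    using additive.add[OF 4(4)] additive.diff[OF 4(4)] by simp
  also have "\<dots> = (\<Sum>bs \<in> delannoy_paths (Suc i) (Suc j).
      (-1) ^ (Suc i + Suc j + length bs) * \<phi> (fold (step_op A B G) bs v))"
    unfolding delannoy_paths_snoc(4) 4(1)[OF add(1) 4(5-7)] 4(2)[OF add(2) 4(5-7)] 4(3)[OF add(3) 4(5-7)]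
    by (subst sum.union_disjoint; (subst sum.union_disjoint)?)
      (auto simp: finite_delannoy_paths sum.reindex inj_on_def step_op_def sum_negf)
  finally show ?case .
qed

text \<open>Operators act on row vectors from the right, so the product written \<open>a e c\<close> above is the
  function \<open>\<lambda>v. c (e (a v))\<close>. The vector \<open>R p r\<close> is the coefficient \<open>L P\<^bsub>p,r\<^esub>\<close> of
  \<open>\<xi>\<^sup>p \<eta>\<^sup>r\<close> in \<open>L \<Pi>\<close>, and \<open>U p r b\<close> is the coefficient of \<open>\<xi>\<^sup>p \<eta>\<^sup>r \<zeta>\<^sup>b\<close> in
  \<open>L C \<Pi>'\<close>.\<close>

locale exchange_operators =
  fixes a y c d E :: "'v::ab_group_add \<Rightarrow> 'v" and L :: 'v
  assumes add_a: "additive a" and add_y: "additive y" and add_c: "additive c"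
    and add_d: "additive d" and add_E: "additive E"
    and ya: "a (y v) = y (a v - E (a v))"
    and dc: "c (d v) = d (c v - E (c v))"
    and Ed: "E (a v) = d (E v)"
    and L: "E L = L"
begin

definition e :: "'v \<Rightarrow> 'v" where "e v = v - E v"

lemmas linear_simps =
  additive.add[OF add_a] additive.add[OF add_y] additive.add[OF add_c] additive.add[OF add_d]
  additive.add[OF add_E] additive.diff[OF add_a] additive.diff[OF add_y] additive.diff[OF add_c]
  additive.diff[OF add_d] additive.diff[OF add_E] additive.zero[OF add_a] additive.zero[OF add_y]
  additive.zero[OF add_c] additive.zero[OF add_d] additive.zero[OF add_E]

definition R :: "nat \<Rightarrow> nat \<Rightarrow> 'v" where
  "R p r = delannoy_sum a c (\<lambda>v. c (e (a v))) L p r"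

definition U :: "nat \<Rightarrow> nat \<Rightarrow> nat \<Rightarrow> 'v" where
  "U p r b = delannoy_sum y d (\<lambda>v. d (e (y v))) ((c ^^ r) L) b p"

text \<open>In product notation \<open>a E c = E d c = E c e d\<close> by \<open>Ed\<close> and
  \<open>dc\<close>. Put \<open>E = 1 - e\<close> at both ends and use
  \<open>e c e d = e d c\<close>.\<close>

lemma exchange_aec: "c (e (a v)) + d (e (c v)) = c (a v) + c (d (e v))"
proof -
  have "c (a v) - c (e (a v)) = c (E (a v))"
    by (simp add: e_def linear_simps)
  also have "\<dots> = d (e (c (E v)))"
    by (simp add: Ed dc e_def)
  also have "\<dots> = d (e (c v)) - c (d (e v))"
    by (simp add: dc e_def linear_simps)
  finally show ?thesis
    by (simp add: algebra_simps)
qed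

definition R_pred :: "nat \<Rightarrow> nat \<Rightarrow> 'v" where
  "R_pred p r = (case p of 0 \<Rightarrow> 0 | Suc p' \<Rightarrow> R p' r)"

text \<open>The case \<open>r = 0\<close> rests on \<open>L e = 0\<close>, and
  \<open>exchange_aec\<close> carries the identity from \<open>r\<close> to \<open>r + 1\<close>.
  For generating functions it means that \<open>L \<Pi> (1 - \<xi>a) (1 - \<xi> e d)\<close> is free
  of \<open>\<xi>\<close>.\<close>

lemma R_Suc: "R (Suc p) r - a (R p r) = d (e (R p r)) - d (e (a (R_pred p r)))"
proof (induction r)
  case 0
  then show ?case
    by (cases p) (auto simp: R_def R_pred_def e_def L linear_simps)
next
  case (Suc r)
  have step: "R (Suc p) (Suc r) - a (R p (Suc r)) = c (R (Suc p) r) - c (e (a (R p r)))"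
    by (simp add: R_def)
  have rec_R: "R p (Suc r) = c (R p r) + a (R_pred p (Suc r)) - c (e (a (R_pred p r)))"
    by (cases p) (auto simp: R_def R_pred_def e_def linear_simps)
  have "d (e (R p (Suc r))) - d (e (a (R_pred p (Suc r)))) =
      d (e (c (R p r))) - d (e (c (e (a (R_pred p r)))))"
    unfolding rec_R by (simp add: e_def linear_simps)
  also have "d (e (c (e (a (R_pred p r))))) = c (d (e (a (R_pred p r))))"
    by (simp add: dc e_def)
  also have "d (e (c (R p r))) = c (a (R p r)) + c (d (e (R p r))) - c (e (a (R p r)))"
    using exchange_aec[of "R p r"] by (simp add: algebra_simps)
  also have "c (a (R p r)) + c (d (e (R p r))) - c (e (a (R p r))) - c (d (e (a (R_pred p r)))) =
      c (a (R p r) + (d (e (R p r)) - d (e (a (R_pred p r))))) - c (e (a (R p r)))"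
    by (simp add: linear_simps)
  also have "\<dots> = c (R (Suc p) r) - c (e (a (R p r)))"
    unfolding Suc.IH[symmetric] by simp
  finally show ?case
    using step by simp
qed

lemma U_0: "U 0 r b = (y ^^ b) (R 0 r)"
  by (simp add: U_def R_def delannoy_sum_0_left delannoy_sum_0_right)

text \<open>Coefficientwise form of \<open>L C \<Pi>' = L \<Pi> K (1 - \<xi> a e)\<close>: the right
  side obeys the recursion of \<open>U\<close>, by \<open>R_Suc\<close> on the edge
  \<open>b = 0\<close> and by \<open>y a = a e y\<close> inside.\<close>

lemma U_eq: "U p r b = (y ^^ b) (R p r) - e (a ((y ^^ b) (R_pred p r)))"
proof (induction p arbitrary: b)
  case 0
  have "additive (y ^^ b)"
    by (induction b) (auto simp: additive_def linear_simps)
  then show ?case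
    by (simp add: U_0 R_pred_def e_def linear_simps additive.zero)
next
  case (Suc p)
  note IH = Suc.IH
  show ?case
  proof (induction b)
    case 0
    have "U (Suc p) r 0 = d (U p r 0)"
      by (simp add: U_def)
    also have "\<dots> = d (R p r) - d (e (a (R_pred p r)))"
      by (simp add: IH linear_simps)
    also have "\<dots> = R (Suc p) r - e (a (R p r))"
      using R_Suc[of p r] by (simp add: e_def linear_simps Ed algebra_simps)
    finally show ?case
      by (simp add: R_pred_def)
  next
    case (Suc b)
    define V W V' where "V = (y ^^ b) (R p r)" and "W = (y ^^ b) (R_pred p r)"
      and "V' = (y ^^ b) (R (Suc p) r)"
    have yea: "y (e (a v)) = a (y v)" for v
      by (simp add: ya e_def)
    have "U (Suc p) r (Suc b) = y (U (Suc p) r b) + d (U p r (Suc b)) - d (e (y (U p r b)))"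
      by (simp add: U_def)
    also have "\<dots> = y (V' - e (a V)) + d (y V - e (a (y W))) - d (e (y (V - e (a W))))"
      unfolding Suc.IH IH V_def W_def V'_def by (simp add: R_pred_def)
    also have "\<dots> = y V' - y (e (a V)) + d (y V) - d (e (a (y W))) - d (e (y V))
        + d (e (y (e (a W))))"
      by (simp add: e_def linear_simps)
    \<comment> \<open>By \<open>yea\<close> the fourth and sixth terms cancel, and
      \<open>d (y V) - d (e (y V)) = d (E (y V)) = E (a (y V))\<close>.\<close>
    also have "\<dots> = y V' - e (a (y V))"
      unfolding yea by (simp add: e_def linear_simps Ed)
    finally show ?case
      by (simp add: V_def V'_def R_pred_def)
  qed
qed

end

section \<open>Row operators\<close>

text \<open>In \<open>v N M n\<close>, \<open>N\<close> is the number of even clusters on the next colour, \<open>M\<close> the number of odd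
  clusters on the last colour and \<open>n\<close> the exponent of \<open>z\<close>. From colour to colour, \<open>N\<close> decreases and
  \<open>M\<close> increases.\<close>

type_synonym row = "nat \<Rightarrow> nat \<Rightarrow> nat \<Rightarrow> rat fps"

definition rpoch :: "nat \<Rightarrow> nat \<Rightarrow> rat fps" where
  "rpoch i j = (if j \<le> i then inverse (q2_poch (i - j)) else 0)"

text \<open>A letter \<open>(s, t)\<close> stands for a colour whose even parts start at index \<open>s\<close> and whose odd parts start
  at index \<open>t\<close>.\<close>

fun wt :: "nat \<times> nat \<Rightarrow> nat \<Rightarrow> nat \<Rightarrow> rat fps" where
  "wt (s, t) N M = q ^ (M + 2 * (N * (N - 1) + M * (M - 1) + N * M + s * N + t * M))"

text \<open>The added colour has counts \<open>N\<close> and \<open>M\<close>. The old row is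
  indexed by \<open>N\<close> and the previous odd count \<open>M'\<close>, the new one by the next
  even count \<open>N'\<close> and by \<open>M\<close>.\<close>

definition act :: "nat \<times> nat \<Rightarrow> row \<Rightarrow> row" where
  "act \<sigma> v = (\<lambda>N' M n. if M \<le> n then
     (\<Sum>N\<le>n - M. \<Sum>M'\<le>M. v N M' (n - M - N) * rpoch M M' * wt \<sigma> N M * rpoch N N') else 0)"

definition shiftN :: "row \<Rightarrow> row" where "shiftN v = (\<lambda>N. v (Suc N))"

definition scaleN :: "row \<Rightarrow> row" where "scaleN v = (\<lambda>N M n. q ^ (2 * N) * v N M n)"

definition mult_z :: "row \<Rightarrow> row" where
  "mult_z v = (\<lambda>N M n. if n = 0 then 0 else v N M (n - 1))"

text \<open>Constant in \<open>N\<close>, as nothing bounds the even count of the first colour; this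
  gives \<open>E L = L\<close>. Odd counts start from 0.\<close>

definition init_row :: row where "init_row = (\<lambda>N M n. if M = 0 \<and> n = 0 then 1 else 0)"

definition final :: "row \<Rightarrow> nat \<Rightarrow> rat fps" where "final v n = (\<Sum>M\<le>n. v 0 M n)"

lemma q2_poch_nth_0: "fps_nth (q2_poch m) 0 = 1"
  by (induction m) (simp_all add: q2_poch_def)

text \<open>All exchange relations come from this identity: pulling \<open>q\<^bsup>2N\<^esup>\<close> through the kernel
  \<open>1 / (q\<^sup>2)\<^bsub>N - N'\<^esub>\<close> costs a factor \<open>1 - E\<close>.\<close>

lemma rpoch_shift: "q ^ (2 * i) * rpoch i j = q ^ (2 * j) * (rpoch i j - rpoch i (Suc j))"
proof (cases "Suc j \<le> i")
  case True
  define m where "m = i - Suc j"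
  have m: "i - j = Suc m" "i - Suc j = m" "i = j + Suc m"
    using True by (auto simp: m_def)
  define x where "x = inverse (q2_poch (Suc m))"
  have unit: "inverse (q2_poch l) * q2_poch l = 1" for l
    by (rule inverse_mult_eq_1) (simp add: q2_poch_nth_0)
  have "q2_poch (Suc m) = q2_poch m * (1 - q ^ (2 * Suc m))"
    by (simp add: q2_poch_def)
  then have "inverse (q2_poch m) * (x * q2_poch (Suc m)) =
      inverse (q2_poch m) * q2_poch m * ((1 - q ^ (2 * Suc m)) * x)"
    by (simp only: mult_ac)
  then have "inverse (q2_poch m) = (1 - q ^ (2 * Suc m)) * x"
    by (simp only: x_def unit mult_1 mult_1_right)
  then have r: "rpoch i j = x" "rpoch i (Suc j) = (1 - q ^ (2 * Suc m)) * x"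
    using True m by (auto simp: rpoch_def x_def)
  have "q ^ (2 * i) = q ^ (2 * j) * q ^ (2 * Suc m)"
    unfolding m(3) by (simp add: power_add)
  then show ?thesis
    unfolding r by (simp only: algebra_simps mult_1)
next
  case False
  then show ?thesis
    by (auto simp: rpoch_def not_le)
qed

lemma additive_act: "additive (act \<sigma>)"
  unfolding additive_def act_def
  by (intro allI ext) (auto simp: distrib_left distrib_right sum.distrib)

lemma additive_shiftN: "additive shiftN"
  by (simp add: additive_def shiftN_def fun_eq_iff)

lemma additive_mult_z: "additive mult_z"
  by (simp add: additive_def mult_z_def fun_eq_iff)

lemma additive_final: "additive (\<lambda>v. final v n)"
  by (simp add: additive_def final_def sum.distrib)

lemma wt_Suc: "wt (Suc s, t) N M = wt (s, t) N M * q ^ (2 * N)"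
  by (simp add: algebra_simps flip: power_add)

lemma act_Suc: "act (Suc s, t) v = scaleN (act (s, t) v - shiftN (act (s, t) v))"
proof (intro ext)
  fix N' M n
  have "v N M' (n - M - N) * rpoch M M' * wt (Suc s, t) N M * rpoch N N' =
      q ^ (2 * N') * (v N M' (n - M - N) * rpoch M M' * wt (s, t) N M * rpoch N N')
      - q ^ (2 * N') * (v N M' (n - M - N) * rpoch M M' * wt (s, t) N M * rpoch N (Suc N'))" for N M'
  proof -
    have "v N M' (n - M - N) * rpoch M M' * wt (Suc s, t) N M * rpoch N N' =
        v N M' (n - M - N) * rpoch M M' * wt (s, t) N M * (q ^ (2 * N) * rpoch N N')"
      unfolding wt_Suc by (simp only: mult_ac)
    also have "\<dots> = v N M' (n - M - N) * rpoch M M' * wt (s, t) N M *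
        (q ^ (2 * N') * (rpoch N N' - rpoch N (Suc N')))"
      by (simp only: rpoch_shift)
    finally show ?thesis
      by (simp only: right_diff_distrib mult_ac)
  qed
  then show "act (Suc s, t) v N' M n =
      scaleN (act (s, t) v - shiftN (act (s, t) v)) N' M n"
    by (simp add: act_def scaleN_def shiftN_def sum_subtractf sum_distrib_left right_diff_distrib
        del: wt.simps)
qed

lemma act_scaleN: "act (s, t) (scaleN v) = act (Suc s, t) v"
  unfolding act_def scaleN_def wt_Suc by (intro ext) (simp add: mult_ac del: wt.simps)

text \<open>By \<open>act_Suc\<close> a unit of \<open>s\<close> becomes \<open>e\<close> followed
  by \<open>q^(2N)\<close>, and the next letter absorbs this factor into its own \<open>s\<close>.
  Instances are \<open>ya\<close>, \<open>dc\<close> and the diagonal steps of paths.\<close>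

lemma exchange: "act (s', t') (act (Suc s, t) v) =
    act (Suc s', t') (act (s, t) v - shiftN (act (s, t) v))"
  by (simp add: act_Suc[of s] act_scaleN)

lemma wt_Suc_left: "wt (0, 0) (Suc N) M = wt (2, 1) N M"
proof -
  have "Suc N * (Suc N - 1) = N * (N - 1) + 2 * N"
    by (cases N) auto
  then show ?thesis
    unfolding wt.simps by (simp only: distrib_left distrib_right mult_Suc mult_0 mult_1 add_0 ac_simps)
qed

lemma rpoch_0_Suc [simp]: "rpoch 0 (Suc j) = 0"
  by (simp add: rpoch_def)

lemma rpoch_Suc_Suc [simp]: "rpoch (Suc i) (Suc j) = rpoch i j"
  by (simp add: rpoch_def)

text \<open>Substitute \<open>N + 1\<close> for \<open>N\<close>: the term \<open>N = 0\<close>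
  dies, the kernel depends only on the difference, the extra cluster gives \<open>z\<close>, and the
  weight changes by \<open>wt_Suc_left\<close>.\<close>

lemma shiftN_act: "shiftN (act (0, 0) v) = mult_z (act (2, 1) (shiftN v))"
proof (intro ext)
  fix N' M n
  consider "n = 0" | n' where "n = Suc n'" "M \<le> n'" | n' where "n = Suc n'" "n' < M"
    by (cases n) (auto simp: not_le[symmetric])
  then show "shiftN (act (0, 0) v) N' M n = mult_z (act (2, 1) (shiftN v)) N' M n"
  proof cases
    case 2
    then have n: "n - M = Suc (n' - M)"
      by simp
    show ?thesis
      unfolding shiftN_def mult_z_def act_def n sum.atMost_Suc_shift wt_Suc_left
      using 2 by (simp add: n del: wt.simps)
  qed (auto simp: shiftN_def mult_z_def act_def)
qed

lemma act_mult_z: "act \<sigma> (mult_z v) = mult_z (act \<sigma> v)"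
proof (intro ext)
  fix N' M n
  consider "n = 0" | n' where "n = Suc n'" "M \<le> n'" | n' where "n = Suc n'" "n' < M"
    by (cases n) (auto simp: not_le[symmetric])
  then show "act \<sigma> (mult_z v) N' M n = mult_z (act \<sigma> v) N' M n"
  proof cases
    case 2
    then have n: "n - M = Suc (n' - M)"
      by simp
    have "Suc (n' - M) - N = Suc (n' - M - N)" if "N \<le> n' - M" for N
      using that by simp
    then show ?thesis
      unfolding mult_z_def act_def n sum.atMost_Suc
      using 2 by (auto intro!: sum.cong)
  qed (auto simp: mult_z_def act_def)
qed

lemma final_scaleN: "final (scaleN v) = final v"
  by (simp add: final_def scaleN_def fun_eq_iff)

section \<open>A model of the exchange relations\<close>

definition Aa :: "row \<Rightarrow> row" where "Aa = (act (0, 0))"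
definition Ay :: "row \<Rightarrow> row" where "Ay = (act (1, 0))"
definition Ac :: "row \<Rightarrow> row" where "Ac = (act (1, 1))"
definition Ad :: "row \<Rightarrow> row" where "Ad = (\<lambda>v. mult_z (act (2, 1) v))"

interpretation X: exchange_operators Aa Ay Ac Ad shiftN init_row
proof (rule exchange_operators.intro)
  show "Aa (Ay v) = Ay (Aa v - shiftN (Aa v))" for v
    using exchange[of 0 0 0 0 v] by (simp add: Aa_def Ay_def)
  show "Ac (Ad v) = Ad (Ac v - shiftN (Ac v))" for v
    using exchange[of 1 1 1 1 v] by (simp add: Ac_def Ad_def act_mult_z numeral_2_eq_2)
  show "shiftN (Aa v) = Ad (shiftN v)" for v
    by (simp add: Aa_def Ad_def shiftN_act)
  show "shiftN init_row = init_row"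
    by (simp add: shiftN_def init_row_def)
  show "additive Ad"
    using additive_act[of "(2, 1)"] additive_mult_z by (simp add: additive_def Ad_def)
qed (simp_all only: Aa_def Ay_def Ac_def additive_act additive_shiftN)

definition word_row :: "(nat \<times> nat) list \<Rightarrow> row" where "word_row w = fold act w init_row"

definition word_val :: "(nat \<times> nat) list \<Rightarrow> nat \<Rightarrow> rat fps" where "word_val w = final (word_row w)"

text \<open>Fermionic candidate for the coefficient of \<open>z^n\<close> in
  \<open>X(p, b, r)\<close>.\<close>

definition config_char :: "nat \<Rightarrow> nat \<Rightarrow> nat \<Rightarrow> nat \<Rightarrow> rat fps" where
  "config_char p b r = final ((Ay ^^ b) (X.R p r))"

lemma config_char_Suc: "config_char (Suc p) b r n = config_char p (Suc b) r n + final (X.U (Suc p) r b) n"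
proof -
  note diff = additive.diff[OF additive_final]
  \<comment> \<open>\<open>act_Suc\<close> turns \<open>y\<close> into \<open>a e\<close> up to the
    factor \<open>q^(2N)\<close>, which is 1 at the index \<open>N = 0\<close> read by
    \<open>final\<close>.\<close>
  have "final (Ay v) n = final (X.e (Aa v)) n" for v
    using act_Suc[of 0 0 v] by (simp add: X.e_def Aa_def Ay_def final_scaleN)
  then show ?thesis
    by (simp add: config_char_def X.U_eq X.R_pred_def diff)
qed

lemma config_char_0: "config_char 0 b r n = final (X.U 0 r b) n"
  by (simp add: config_char_def X.U_0)

section \<open>From paths to words\<close>

lemma word_row_support: "n < M \<Longrightarrow> word_row w N M n = 0"
  by (cases w rule: rev_cases) (auto simp: word_row_def init_row_def act_def)

lemma mult_z_power: "(mult_z ^^ p) v N M n = (if p \<le> n then v N M (n - p) else 0)"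
  by (induction p arbitrary: n) (auto simp: mult_z_def)

lemma final_mult_z: "final ((mult_z ^^ p) (word_row w)) n = (if p \<le> n then word_val w (n - p) else 0)"
proof (cases "p \<le> n")
  case True
  have "(\<Sum>M\<le>n. word_row w 0 M (n - p)) = (\<Sum>M\<le>n - p. word_row w 0 M (n - p))"
    by (rule sum.mono_neutral_right) (auto intro: word_row_support)
  with True show ?thesis
    by (simp add: final_def word_val_def mult_z_power)
qed (simp add: final_def mult_z_power)

lemma act_mult_z_power: "act \<sigma> ((mult_z ^^ p) v) = (mult_z ^^ p) (act \<sigma> v)"
  by (induction p) (simp_all add: act_mult_z)

lemma fold_replicate: "fold f (replicate n x) v = (f x ^^ n) v"
  by (induction n arbitrary: v) (auto simp: funpow_swap1)

text \<open>\<open>exchange\<close> turns the operator of a diagonal step into a product of two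
  letters without \<open>e\<close>, so each path becomes a word.\<close>

definition blockR :: "nat \<times> nat \<Rightarrow> (nat \<times> nat) list" where
  "blockR x = (if x = (1, 0) then [(0, 0)] else if x = (0, 1) then [(1, 1)] else [(1, 0), (0, 1)])"

definition blockU :: "nat \<times> nat \<Rightarrow> (nat \<times> nat) list" where
  "blockU x = (if x = (1, 0) then [(1, 0)] else if x = (0, 1) then [(2, 1)] else [(2, 0), (1, 1)])"

lemma fold_step_R:
  assumes "set bs \<subseteq> {(1, 0), (0, 1), (1, 1)}"
  shows "fold (step_op Aa Ac (\<lambda>v. Ac (X.e (Aa v)))) bs v = fold act (concat (map blockR bs)) v"
  using assms
proof (induction bs arbitrary: v)
  case (Cons x bs)
  have "act (0, 1) (act (1, 0) v) = Ac (X.e (Aa v))" for v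
    using exchange[of 0 1 0 0 v] by (simp add: X.e_def Aa_def Ac_def)
  with Cons show ?case
    by (auto simp: step_op_def blockR_def Aa_def Ac_def)
qed simp

lemma fold_step_U:
  assumes "set bs \<subseteq> {(1, 0), (0, 1), (1, 1)}"
  shows "fold (step_op Ay Ad (\<lambda>v. Ad (X.e (Ay v)))) bs ((mult_z ^^ i) v) =
    (mult_z ^^ (i + sum_list (map snd bs))) (fold act (concat (map blockU bs)) v)"
  using assms
proof (induction bs arbitrary: v i)
  case (Cons x bs)
  have g: "mult_z (act (1, 1) (act (2, 0) v)) = Ad (X.e (Ay v))" for v
    using exchange[of 1 1 1 0 v] by (simp add: X.e_def Ad_def Ay_def numeral_2_eq_2)
  have x: "x \<in> {(1, 0), (0, 1), (1, 1)}" and bs: "set bs \<subseteq> {(1, 0), (0, 1), (1, 1)}"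
    using Cons.prems by auto
  have "Ad (X.e (Ay ((mult_z ^^ i) v))) = (mult_z ^^ Suc i) (act (1, 1) (act (2, 0) v))"
    unfolding g[symmetric] by (simp add: act_mult_z_power)
  then have "step_op Ay Ad (\<lambda>v. Ad (X.e (Ay v))) x ((mult_z ^^ i) v) =
      (mult_z ^^ (i + snd x)) (fold act (blockU x) v)"
    using x by (auto simp: step_op_def blockU_def Ay_def Ad_def act_mult_z_power)
  then show ?case
    using Cons.IH[OF bs] by (simp add: add.assoc)
qed simp

lemma config_char_eq_sum: "config_char p b r n = (\<Sum>bs \<in> delannoy_paths p r. (-1) ^ (p + r + length bs) *
    word_val (concat (map blockR bs) @ replicate b (1, 0)) n)"
proof -
  have "additive (\<lambda>v. final ((Ay ^^ b) v) n)"
  proof -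
    have "additive (Ay ^^ b)"
      by (induction b) (auto simp: additive_def X.linear_simps)
    then show ?thesis
      using additive_final[of n] by (simp add: additive_def)
  qed
  moreover have "additive (\<lambda>v. Ac (X.e (Aa v)))"
    by (simp add: additive_def X.e_def X.linear_simps)
  moreover have "final ((Ay ^^ b) (fold (step_op Aa Ac (\<lambda>v. Ac (X.e (Aa v)))) bs init_row)) n =
      word_val (concat (map blockR bs) @ replicate b (1, 0)) n" if "bs \<in> delannoy_paths p r" for bs
    using that
    by (simp add: fold_step_R delannoy_paths_def word_val_def word_row_def fold_replicate Ay_def)
  ultimately show ?thesis
    unfolding config_char_def X.R_def
    by (simp add: delannoy_sum_eq[where \<phi> = "\<lambda>v. final ((Ay ^^ b) v) n"] X.add_a X.add_c)
qed

lemma final_U_eq_sum: "final (X.U p r b) n = (\<Sum>bs \<in> delannoy_paths b p. (-1) ^ (b + p + length bs) *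
    (if p \<le> n then word_val (replicate r (1, 1) @ concat (map blockU bs)) (n - p) else 0))"
proof -
  have "additive (\<lambda>v. Ad (X.e (Ay v)))"
    by (simp add: additive_def X.e_def X.linear_simps)
  moreover have "final (fold (step_op Ay Ad (\<lambda>v. Ad (X.e (Ay v)))) bs ((Ac ^^ r) init_row)) n =
      (if p \<le> n then word_val (replicate r (1, 1) @ concat (map blockU bs)) (n - p) else 0)"
    if "bs \<in> delannoy_paths b p" for bs
  proof -
    have "fold (step_op Ay Ad (\<lambda>v. Ad (X.e (Ay v)))) bs ((Ac ^^ r) init_row) =
        (mult_z ^^ p) (word_row (replicate r (1, 1) @ concat (map blockU bs)))"
      using that fold_step_U[of bs 0 "(Ac ^^ r) init_row"]
      by (simp add: delannoy_paths_def word_row_def fold_replicate Ac_def)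
    then show ?thesis
      by (simp add: final_mult_z)
  qed
  ultimately show ?thesis
    unfolding X.U_def
    by (simp add: delannoy_sum_eq[where \<phi> = "\<lambda>v. final v n"] X.add_y X.add_d additive_final)
qed

section \<open>Expansion of words over profiles\<close>

text \<open>Profiles need not be monotone: on the others, the factors \<open>chain\<close> below vanish.\<close>

definition profiles :: "nat \<Rightarrow> nat \<Rightarrow> (nat \<times> nat) list set" where
  "profiles k n = {ps. length ps = k \<and> sum_list (map (\<lambda>(N, M). N + M) ps) = n}"

fun chain :: "nat list \<Rightarrow> rat fps" where
  "chain (i # j # is) = rpoch i j * chain (j # is)"
| "chain _ = 1"

definition profile_wt :: "(nat \<times> nat) list \<Rightarrow> (nat \<times> nat) list \<Rightarrow> rat fps" where
  "profile_wt w ps = prod_list (map2 (\<lambda>\<sigma> (N, M). wt \<sigma> N M) w ps)"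

lemma chain_snoc: "chain (is @ [i, j]) = chain (is @ [i]) * rpoch i j"
  by (induction "is" rule: chain.induct) (auto simp: mult_ac)

lemma mem_profile_le:
  assumes "ps \<in> profiles k n" "(N, M) \<in> set ps"
  shows "N + M \<le> n"
proof -
  have "N + M \<in> set (map (\<lambda>(N, M). N + M) ps)"
    using assms(2) by force
  then show ?thesis
    using assms(1) member_le_sum_list[of "N + M" "map (\<lambda>(N, M). N + M) ps"]
    unfolding profiles_def by blast
qed

lemma finite_profiles: "finite (profiles k n)"
proof (rule finite_subset)
  show "profiles k n \<subseteq> {ps. set ps \<subseteq> {..n} \<times> {..n} \<and> length ps = k}"
    using mem_profile_le by (fastforce simp: profiles_def)
qed (auto intro: finite_lists_length_eq)

lemma sum_profiles_Suc:
  "(\<Sum>ps \<in> profiles (Suc k) n. f ps) =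
    (\<Sum>M\<le>n. \<Sum>N\<le>n - M. \<Sum>ps \<in> profiles k (n - M - N). f (ps @ [(N, M)]))"
proof -
  have "(\<Sum>M\<le>n. \<Sum>N\<le>n - M. \<Sum>ps \<in> profiles k (n - M - N). f (ps @ [(N, M)])) =
    (\<Sum>(M, N, ps) \<in> (SIGMA M:{..n}. SIGMA N:{..n - M}. profiles k (n - M - N)). f (ps @ [(N, M)]))"
    by (simp add: sum.Sigma finite_profiles split_beta)
  also have "\<dots> = (\<Sum>ps \<in> profiles (Suc k) n. f ps)"
    by (rule sum.reindex_bij_witness[where
          i = "\<lambda>ps. (snd (last ps), fst (last ps), butlast ps)" and j = "\<lambda>(M, N, ps). ps @ [(N, M)]"])
      (auto simp: profiles_def length_Suc_conv_rev split: prod.splits)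
  finally show ?thesis ..
qed

text \<open>The even chain is closed by the outgoing index \<open>N'\<close>; the odd chain is read
  backwards and closed by the initial 0. The \<open>hd\<close> is the last odd count, or 0 for the
  empty word.\<close>

lemma word_row_eq: "word_row w N' M n = (\<Sum>ps \<in> profiles (length w) n.
    if hd (rev (map snd ps) @ [0]) = M
    then profile_wt w ps * chain (map fst ps @ [N']) * chain (rev (map snd ps) @ [0]) else 0)"
proof (induction w arbitrary: N' M n rule: rev_induct)
  case Nil
  have "profiles 0 n = (if n = 0 then {[]} else {})"
    by (auto simp: profiles_def)
  then show ?case
    by (auto simp: word_row_def init_row_def profile_wt_def)
next
  case (snoc \<sigma> w)
  let ?k = "length w"
  define T where "T ps N = profile_wt w ps * chain (map fst ps @ [N]) * chain (rev (map snd ps) @ [0])"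
    for ps and N :: nat
  define h :: "(nat \<times> nat) list \<Rightarrow> nat" where "h ps = hd (rev (map snd ps) @ [0])" for ps
  have T_snoc: "profile_wt (w @ [\<sigma>]) (ps @ [(N, M)]) * chain (map fst (ps @ [(N, M)]) @ [N']) *
      chain (rev (map snd (ps @ [(N, M)])) @ [0]) = T ps N * rpoch M (h ps) * wt \<sigma> N M * rpoch N N'"
    if "ps \<in> profiles ?k n'" for ps N M n'
  proof -
    have "profile_wt (w @ [\<sigma>]) (ps @ [(N, M)]) = profile_wt w ps * wt \<sigma> N M"
      using that by (simp add: profile_wt_def profiles_def)
    moreover have "chain (M # rev (map snd ps) @ [0]) =
        rpoch M (h ps) * chain (rev (map snd ps) @ [0])"
      by (cases ps rule: rev_cases) (auto simp: h_def)
    ultimately show ?thesis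
      by (simp add: chain_snoc T_def mult_ac)
  qed
  have inner: "(\<Sum>M'\<le>M. word_row w N M' n' * rpoch M M' * wt \<sigma> N M * rpoch N N') =
      (\<Sum>ps \<in> profiles ?k n'. T ps N * rpoch M (h ps) * wt \<sigma> N M * rpoch N N')" for N n'
  proof -
    have "(\<Sum>M'\<le>M. word_row w N M' n' * rpoch M M' * wt \<sigma> N M * rpoch N N') =
        (\<Sum>M'\<le>M. \<Sum>ps \<in> profiles ?k n'. if h ps = M'
          then T ps N * rpoch M M' * wt \<sigma> N M * rpoch N N' else 0)"
      unfolding snoc.IH sum_distrib_right T_def h_def by (intro sum.cong refl) auto
    also have "\<dots> = (\<Sum>ps \<in> profiles ?k n'. \<Sum>M'\<le>M. if h ps = M'
          then T ps N * rpoch M M' * wt \<sigma> N M * rpoch N N' else 0)"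
      by (rule sum.swap)
    also have "\<dots> = (\<Sum>ps \<in> profiles ?k n'. T ps N * rpoch M (h ps) * wt \<sigma> N M * rpoch N N')"
      by (intro sum.cong refl) (auto simp: rpoch_def)
    finally show ?thesis .
  qed
  have "word_row (w @ [\<sigma>]) N' M n = (if M \<le> n then
      (\<Sum>N\<le>n - M. \<Sum>ps \<in> profiles ?k (n - M - N). T ps N * rpoch M (h ps) * wt \<sigma> N M * rpoch N N') else 0)"
    by (simp add: word_row_def act_def inner[unfolded word_row_def])
  also have "\<dots> = (\<Sum>M0\<le>n. if M0 = M then
      (\<Sum>N\<le>n - M0. \<Sum>ps \<in> profiles ?k (n - M0 - N).
        T ps N * rpoch M0 (h ps) * wt \<sigma> N M0 * rpoch N N') else 0)"
    by simp
  also have "\<dots> = (\<Sum>M0\<le>n. \<Sum>N\<le>n - M0. \<Sum>ps \<in> profiles ?k (n - M0 - N). if M0 = M then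
        T ps N * rpoch M0 (h ps) * wt \<sigma> N M0 * rpoch N N' else 0)"
    by (intro sum.cong refl) auto
  also have "\<dots> = (\<Sum>ps \<in> profiles (length (w @ [\<sigma>])) n.
    if hd (rev (map snd ps) @ [0]) = M
    then profile_wt (w @ [\<sigma>]) ps * chain (map fst ps @ [N']) * chain (rev (map snd ps) @ [0]) else 0)"
    unfolding length_append list.size add_Suc_right add_0_right One_nat_def sum_profiles_Suc
    using T_snoc by (intro sum.cong refl) auto
  finally show ?case .
qed

lemma word_val_eq: "word_val w n = (\<Sum>ps \<in> profiles (length w) n.
    profile_wt w ps * chain (map fst ps @ [0]) * chain (rev (map snd ps) @ [0]))"
proof -
  have le: "hd (rev (map snd ps) @ [0]) \<le> n" if "ps \<in> profiles (length w) n" for ps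
    using that by (cases ps rule: rev_cases) (auto simp: profiles_def)
  have "word_val w n = (\<Sum>ps \<in> profiles (length w) n. \<Sum>M\<le>n.
      if hd (rev (map snd ps) @ [0]) = M
      then profile_wt w ps * chain (map fst ps @ [0]) * chain (rev (map snd ps) @ [0]) else 0)"
    unfolding word_val_def final_def word_row_eq by (rule sum.swap)
  then show ?thesis
    using le by (simp cong: sum.cong)
qed

text \<open>Shifting a configuration by one position swaps even and odd positions; on words this reverses the
  colours.\<close>

definition mirror_letter :: "nat \<times> nat \<Rightarrow> nat \<times> nat" where
  "mirror_letter = (\<lambda>(s, t). (Suc t, s))"

definition mirror :: "(nat \<times> nat) list \<Rightarrow> (nat \<times> nat) list" where
  "mirror w = rev (map mirror_letter w)"

lemma wt_mirror_letter: "wt (mirror_letter \<sigma>) M N = q ^ (N + M) * wt \<sigma> N M"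
  by (cases \<sigma>) (simp add: mirror_letter_def algebra_simps flip: power_add)

lemma profile_wt_mirror:
  assumes "length w = length ps"
  shows "profile_wt (mirror w) (rev (map prod.swap ps)) =
    q ^ sum_list (map (\<lambda>(N, M). N + M) ps) * profile_wt w ps"
proof -
  have "profile_wt (mirror w) (rev (map prod.swap ps)) =
      prod_list (map2 (\<lambda>\<sigma> (N, M). wt \<sigma> N M) (map mirror_letter w) (map prod.swap ps))"
    using assms by (simp add: profile_wt_def mirror_def zip_rev prod_list.rev flip: rev_map)
  also have "\<dots> = q ^ sum_list (map (\<lambda>(N, M). N + M) ps) * profile_wt w ps"
    unfolding profile_wt_def using assms
  proof (induction w ps rule: list_induct2)
    case (Cons \<sigma> w x ps)
    then show ?case
      by (cases x) (simp add: wt_mirror_letter power_add mult_ac del: wt.simps)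
  qed simp
  finally show ?thesis .
qed

text \<open>Reversing a profile and swapping its components interchanges the two chains, which use
  the same kernel; the letterwise factors \<open>q^(N + M)\<close> multiply up to
  \<open>q^n\<close>.\<close>

lemma word_val_mirror: "word_val (mirror w) n = q ^ n * word_val w n"
proof -
  have "word_val (mirror w) n = (\<Sum>ps \<in> profiles (length w) n. 
      profile_wt (mirror w) (rev (map prod.swap ps)) * chain (map fst ps @ [0]) *
      chain (rev (map snd ps) @ [0]))"
    unfolding word_val_eq
    by (rule sum.reindex_bij_witness[where i = "\<lambda>ps. rev (map prod.swap ps)"
          and j = "\<lambda>ps. rev (map prod.swap ps)"])
      (auto simp: profiles_def mirror_def o_def rev_map sum_list_rev case_prod_unfold add.commute
        mult_ac simp flip: rev_map)
  also have "\<dots> = q ^ n * word_val w n"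
    unfolding word_val_eq sum_distrib_left
    by (intro sum.cong refl) (auto simp: profiles_def profile_wt_mirror mult_ac)
  finally show ?thesis .
qed

lemma mirror_blockR: "mirror (concat (map blockR bs)) = concat (map blockU (rev bs))"
proof (induction bs)
  case (Cons x bs)
  have "mirror (blockR x) = blockU x"
    by (auto simp: mirror_def blockR_def blockU_def mirror_letter_def)
  with Cons show ?case
    by (simp add: mirror_def)
qed (simp add: mirror_def)

text \<open>Mirroring the words of \<open>P(b, p) y^r\<close> gives those of \<open>U p r b\<close>,
  with the paths reversed. Each path carries \<open>p\<close> factors \<open>d\<close>, hence
  \<open>z^p\<close>.\<close>

lemma final_U: "final (X.U p r b) n = (if p \<le> n then q ^ (n - p) * config_char b r p (n - p) else 0)"
proof (cases "p \<le> n")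
  case True
  have mirror: "mirror (concat (map blockR bs) @ replicate r (1, 0)) =
      replicate r (1, 1) @ concat (map blockU (rev bs))" for bs
    using mirror_blockR[of bs] by (simp add: mirror_def mirror_letter_def)
  have "final (X.U p r b) n = (\<Sum>bs \<in> delannoy_paths b p. (-1) ^ (b + p + length bs) *
      word_val (replicate r (1, 1) @ concat (map blockU bs)) (n - p))"
    using True by (simp add: final_U_eq_sum)
  also have "\<dots> = (\<Sum>bs \<in> delannoy_paths b p. (-1) ^ (b + p + length bs) *
      word_val (mirror (concat (map blockR bs) @ replicate r (1, 0))) (n - p))"
    unfolding mirror
    by (rule sum.reindex_bij_witness[where i = rev and j = rev]) (auto simp: rev_delannoy_paths)
  also have "\<dots> = q ^ (n - p) * config_char b r p (n - p)"
    unfolding word_val_mirror config_char_eq_sum sum_distrib_left by (simp add: mult_ac)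
  finally show ?thesis
    using True by simp
qed (simp add: final_U_eq_sum)

lemma config_char_rec:
  "config_char (Suc p) b r n = config_char p (Suc b) r n +
     (if Suc p \<le> n then q ^ (n - Suc p) * config_char b r (Suc p) (n - Suc p) else 0)"
  by (simp add: config_char_Suc final_U)

lemma config_char_rec_0: "config_char 0 b r n = q ^ n * config_char b r 0 n"
  by (simp add: config_char_0 final_U)

lemma config_char_word: "config_char p b 0 n = word_val (replicate p (0, 0) @ replicate b (1, 0)) n"
  unfolding config_char_def X.R_def delannoy_sum_0_right
  by (simp add: word_val_def word_row_def fold_replicate Aa_def Ay_def)

text \<open>At charge 0 the recursions only move parameters, here until \<open>b\<close> has
  absorbed \<open>p\<close> and \<open>r\<close>. What is left is a power of \<open>y\<close>, with
  one profile, all zero.\<close>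

lemma config_char_charge_0: "config_char p b r 0 = 1"
proof -
  have rec: "config_char p b r 0 = config_char 0 (p + b) r 0" for p b r
    by (induction p arbitrary: b) (auto simp: config_char_rec)
  have "config_char p b r 0 = config_char (p + b) r 0 0"
    by (simp add: rec[of p] config_char_rec_0)
  also have "\<dots> = config_char 0 (p + b + r) 0 0"
    by (simp add: rec[of "p + b"])
  also have "\<dots> = 1"
  proof -
    define k where "k = p + b + r"
    have "profiles k 0 = {replicate k (0, 0)}"
      by (auto simp: profiles_def intro!: replicate_eqI)
    moreover have "chain (replicate k 0 @ [0]) = 1" for k
    proof (induction k)
      case (Suc k)
      then show ?case
        by (cases k) (auto simp: rpoch_def q2_poch_def)
    qed simp
    moreover have "profile_wt (replicate k (1, 0)) (replicate k (0, 0)) = 1"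
      by (induction k) (auto simp: profile_wt_def)
    ultimately show ?thesis
      by (simp add: config_char_word word_val_eq flip: k_def)
  qed
  finally show ?thesis .
qed

section \<open>Counting configurations\<close>

lemma support_case_nat: "{i. case_nat x f i \<noteq> (0::nat)} \<subseteq> insert 0 (Suc ` {i. f i \<noteq> 0})"
proof
  fix i assume "i \<in> {i. case_nat x f i \<noteq> 0}"
  then show "i \<in> insert 0 (Suc ` {i. f i \<noteq> 0})"
    by (cases i) auto
qed

lemma weight_charge_case_nat:
  assumes "finite {i. f i \<noteq> 0}"
  shows "weight (case_nat x f) = weight f + charge f" "charge (case_nat x f) = x + charge f"
proof -
  let ?F = "{i. f i \<noteq> 0}"
  have sub: "{i. case_nat x f i \<noteq> 0} \<subseteq> insert 0 (Suc ` ?F)"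
    by (rule support_case_nat)
  have "weight (case_nat x f) = (\<Sum>i \<in> insert 0 (Suc ` ?F). i * case_nat x f i)"
    unfolding weight_def using assms sub by (intro sum.mono_neutral_left) auto
  also have "\<dots> = (\<Sum>i \<in> ?F. Suc i * f i)"
    using assms by (simp add: sum.reindex)
  finally show "weight (case_nat x f) = weight f + charge f"
    by (simp add: weight_def charge_def sum.distrib)
  have "charge (case_nat x f) = (\<Sum>i \<in> insert 0 (Suc ` ?F). case_nat x f i)"
    unfolding charge_def using assms sub by (intro sum.mono_neutral_left) auto
  also have "\<dots> = x + (\<Sum>i \<in> ?F. f i)"
    using assms by (simp add: sum.reindex)
  finally show "charge (case_nat x f) = x + charge f"
    by (simp add: charge_def)
qed

lemma finite_support_case_nat: "finite {i. case_nat x f i \<noteq> (0::nat)} \<longleftrightarrow> finite {i. f i \<noteq> 0}"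
proof
  assume "finite {i. case_nat x f i \<noteq> 0}"
  moreover have "Suc ` {i. f i \<noteq> 0} \<subseteq> {i. case_nat x f i \<noteq> 0}"
    by auto
  ultimately show "finite {i. f i \<noteq> 0}"
    by (meson finite_imageD finite_subset inj_Suc inj_on_subset subset_UNIV)
next
  assume "finite {i. f i \<noteq> 0}"
  then show "finite {i. case_nat x f i \<noteq> 0}"
    by (intro finite_subset[OF support_case_nat]) simp
qed

lemma all_nat_split: "(\<forall>i. P i) \<longleftrightarrow> P 0 \<and> (\<forall>i. P (Suc i))"
  by (metis nat.exhaust)

lemma admissible3_case_nat:
  "admissible3 k (case_nat x f) \<longleftrightarrow> x + f 0 + f 1 \<le> k \<and> admissible3 k f"
  unfolding admissible3_def finite_support_case_nat
  by (subst (1 2) all_nat_split) auto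

section \<open>Recursion for the number of configurations\<close>

definition configs :: "nat \<Rightarrow> nat \<Rightarrow> nat \<Rightarrow> nat \<Rightarrow> nat \<Rightarrow> (nat \<Rightarrow> nat) set" where
  "configs k b0 b1 d n = {a \<in> C3 k b0 b1. weight a = d \<and> charge a = n}"

lemma finite_configs: "finite (configs k b0 b1 d n)"
  unfolding configs_def by (rule finite_C3_weight_charge)

lemma case_nat_in_configs:
  assumes "b1 \<le> k"
  shows "case_nat x f \<in> configs k b0 b1 d n \<longleftrightarrow> x \<le> b0 \<and> x \<le> b1 \<and> x \<le> n \<and> n - x \<le> d \<and>
    f \<in> configs k (b1 - x) (k - x) (d - (n - x)) (n - x)"
proof (cases "admissible3 k f")
  case True
  then have "finite {i. f i \<noteq> 0}"
    by (simp add: admissible3_def)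
  with True assms show ?thesis
    by (auto simp: configs_def C3_def admissible3_case_nat weight_charge_case_nat)
qed (simp add: configs_def C3_def admissible3_case_nat)

lemma case_nat_eq_iff: "case_nat x f = case_nat y g \<longleftrightarrow> x = y \<and> f = g"
proof
  assume eq: "case_nat x f = case_nat y g"
  show "x = y \<and> f = g"
    using fun_cong[OF eq, of 0] fun_cong[OF eq, of "Suc i" for i] by auto
qed simp

lemma case_nat_in_image: "case_nat x f \<in> case_nat y ` A \<longleftrightarrow> x = y \<and> f \<in> A"
  by (auto simp: image_iff case_nat_eq_iff)

lemma inj_case_nat: "inj_on (case_nat x) A"
  by (auto intro: inj_onI simp: case_nat_eq_iff)

lemma eq_case_nat: "a = case_nat (a 0) (\<lambda>i. a (Suc i))"
  by (auto split: nat.splits)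

text \<open>Either \<open>a 0 \<le> p\<close>, or \<open>a 0 = Suc p\<close> is stripped. For
  \<open>b1 = Suc p + b\<close> and \<open>k = b1 + r\<close> the tail has the parameters
  \<open>(b, r, Suc p)\<close>, as in \<open>config_char_rec\<close>.\<close>

lemma configs_Suc:
  assumes "Suc p \<le> b1" "b1 \<le> k"
  shows "card (configs k (Suc p) b1 d n) = card (configs k p b1 d n) +
    (if Suc p \<le> n \<and> n - Suc p \<le> d
     then card (configs k (b1 - Suc p) (k - Suc p) (d - (n - Suc p)) (n - Suc p)) else 0)"
proof -
  let ?S = "{f. Suc p \<le> n \<and> n - Suc p \<le> d \<and>
    f \<in> configs k (b1 - Suc p) (k - Suc p) (d - (n - Suc p)) (n - Suc p)}"
  have "a \<in> configs k (Suc p) b1 d n \<longleftrightarrow>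
      a \<in> configs k p b1 d n \<union> case_nat (Suc p) ` ?S" for a
  proof -
    obtain x f where a: "a = case_nat x f"
      using eq_case_nat by blast
    show ?thesis
      unfolding a using assms by (auto simp: case_nat_in_configs case_nat_in_image le_Suc_eq)
  qed
  then have "configs k (Suc p) b1 d n = configs k p b1 d n \<union> case_nat (Suc p) ` ?S"
    by blast
  moreover have "configs k p b1 d n \<inter> case_nat (Suc p) ` ?S = {}"
    by (auto simp: configs_def C3_def)
  moreover have "finite ?S"
    by (cases "Suc p \<le> n \<and> n - Suc p \<le> d") (auto simp: finite_configs)
  ultimately have "card (configs k (Suc p) b1 d n) = card (configs k p b1 d n) + card ?S"
    by (simp add: card_Un_disjoint finite_configs card_image[OF inj_case_nat])
  also have "card ?S = (if Suc p \<le> n \<and> n - Suc p \<le> d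
      then card (configs k (b1 - Suc p) (k - Suc p) (d - (n - Suc p)) (n - Suc p)) else 0)"
    by (cases "Suc p \<le> n"; cases "n - Suc p \<le> d") simp_all
  finally show ?thesis .
qed

lemma configs_0:
  assumes "b1 \<le> k"
  shows "card (configs k 0 b1 d n) = (if n \<le> d then card (configs k b1 k (d - n) n) else 0)"
proof -
  have "configs k 0 b1 d n = case_nat 0 ` {f. n \<le> d \<and> f \<in> configs k b1 k (d - n) n}"
  proof -
    have "a \<in> configs k 0 b1 d n \<longleftrightarrow> a \<in> case_nat 0 ` {f. n \<le> d \<and> f \<in> configs k b1 k (d - n) n}" for a
    proof -
      obtain x f where a: "a = case_nat x f"
        using eq_case_nat by blast
      show ?thesis
        unfolding a using assms by (auto simp: case_nat_in_configs case_nat_in_image)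
    qed
    then show ?thesis
      by blast
  qed
  then show ?thesis
    by (simp add: card_image[OF inj_case_nat])
qed

lemma configs_charge_0: "configs k b0 b1 d 0 = (if d = 0 then {\<lambda>_. 0} else {})"
proof -
  have "a = (\<lambda>_. 0)" if "admissible3 k a" "charge a = 0" for a
    using that by (auto simp: admissible3_def charge_def)
  then have "a = (\<lambda>_. 0)" if "a \<in> configs k b0 b1 d 0" for a
    using that by (simp add: configs_def C3_def)
  moreover have "(\<lambda>_. 0) \<in> configs k b0 b1 d 0 \<longleftrightarrow> d = 0"
    by (auto simp: configs_def C3_def admissible3_def charge_def weight_def)
  ultimately show ?thesis
    by auto
qed

text \<open>Lexicographic induction on charge, weight and \<open>p\<close>: stripping
  \<open>a 0 = Suc p\<close> lowers the charge, stripping \<open>a 0 = 0\<close> lowers the weight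
  by \<open>n > 0\<close>, and the other term lowers \<open>p\<close>.\<close>

theorem config_char_nth:
  "fps_nth (config_char p b r n) d = of_nat (card (configs (p + b + r) p (p + b) d n))"
proof (induction n arbitrary: d p b r rule: less_induct)
  case less_n: (less n)
  show ?case
  proof (cases "n = 0")
    case True
    then show ?thesis
      by (simp add: config_char_charge_0 configs_charge_0)
  next
    case False
    show ?thesis
    proof (induction d arbitrary: p b r rule: less_induct)
      case less_d: (less d)
      show ?case
      proof (induction p arbitrary: b r)
        case 0
        show ?case
          using less_d[of "d - n" b r 0] False
          by (simp add: config_char_rec_0 configs_0 fps_X_power_mult_nth)
      next
        case (Suc p)
        show ?case
          using Suc[of "Suc b" r] less_n[of "n - Suc p" b r "Suc p" "d - (n - Suc p)"] False
          by (auto simp: config_char_rec configs_Suc fps_X_power_mult_nth add_ac)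
      qed
    qed
  qed
qed

section \<open>The fermionic sum\<close>

definition tail_sum :: "nat \<Rightarrow> nat vec \<Rightarrow> nat \<Rightarrow> nat" where
  "tail_sum k m i = (\<Sum>j = i..<k. m $ j)"

definition size_of :: "nat \<Rightarrow> nat vec \<Rightarrow> nat" where
  "size_of k m = (\<Sum>j = 1..k. j * m $ (j - 1))"

text \<open>Counting colours from 0, colour \<open>i\<close> carries \<open>N_{i+1}\<close> and
  \<open>M_{k-i}\<close>; the reversal places odd clusters in the last colours.\<close>

definition profile :: "nat \<Rightarrow> nat vec \<Rightarrow> nat vec \<Rightarrow> (nat \<times> nat) list" where
  "profile k m1 m2 = map (\<lambda>i. (tail_sum k m1 i, tail_sum k m2 (k - 1 - i))) [0..<k]"

lemma tail_sum_rec: "i < k \<Longrightarrow> tail_sum k m i = m $ i + tail_sum k m (Suc i)"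
  by (simp add: tail_sum_def sum.atLeast_Suc_lessThan)

lemma tail_sum_self [simp]: "tail_sum k m k = 0"
  by (simp add: tail_sum_def)

lemma tail_sum_eq: "tail_sum k m i = (\<Sum>j<k. if i \<le> j then m $ j else 0)"
  unfolding tail_sum_def by (rule sum.mono_neutral_cong_left) auto

lemma size_of_eq: "size_of k m = (\<Sum>j<k. Suc j * m $ j)"
  unfolding size_of_def by (rule sum.reindex_bij_witness[where i = Suc and j = "\<lambda>j. j - 1"]) auto

lemma sum_tail_sum: "(\<Sum>i<k. tail_sum k m i) = size_of k m"
proof -
  have "(\<Sum>i<k. tail_sum k m i) = (\<Sum>i<k. \<Sum>j<k. if i \<le> j then m $ j else 0)"
    by (simp add: tail_sum_eq)
  also have "\<dots> = (\<Sum>j<k. \<Sum>i<k. if i \<le> j then m $ j else 0)"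
    by (rule sum.swap)
  also have "\<dots> = (\<Sum>j<k. Suc j * m $ j)"
  proof (intro sum.cong refl)
    fix j assume "j \<in> {..<k}"
    then have "{..<k} \<inter> {i. i \<le> j} = {..j}"
      by auto
    then show "(\<Sum>i<k. if i \<le> j then m $ j else 0) = Suc j * m $ j"
      by (simp add: sum.If_cases)
  qed
  finally show ?thesis
    by (simp only: size_of_eq)
qed

lemma sum_rev_lessThan: "(\<Sum>i<k. f (k - 1 - i)) = (\<Sum>i<k. f (i::nat))" for f :: "nat \<Rightarrow> 'a::comm_monoid_add"
  by (rule sum.reindex_bij_witness[where i = "\<lambda>i. k - 1 - i" and j = "\<lambda>i. k - 1 - i"]) auto

lemma profile_in_profiles: "profile k m1 m2 \<in> profiles k n \<longleftrightarrow> size_of k m1 + size_of k m2 = n"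
proof -
  have "(\<Sum>i<k. tail_sum k m2 (k - 1 - i)) = size_of k m2"
    by (simp only: sum_rev_lessThan sum_tail_sum)
  then show ?thesis
    by (simp add: profile_def profiles_def o_def interv_sum_list_conv_sum_set_nat sum.distrib
        sum_tail_sum atLeast0LessThan)
qed

lemma map_fst_profile: "map fst (profile k m1 m2) @ [0] = map (tail_sum k m1) [0..<Suc k]"
  by (simp add: profile_def)

lemma rev_map_snd_profile: "rev (map snd (profile k m1 m2)) @ [0] = map (tail_sum k m2) [0..<Suc k]"
  by (auto simp: profile_def rev_map rev_nth intro!: nth_equalityI simp: nth_append)

lemma chain_tail_sum:
  "i \<le> k \<Longrightarrow> chain (map (tail_sum k m) [i..<Suc k]) = (\<Prod>j = i..<k. inverse (q2_poch (m $ j)))"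
proof (induction i rule: inc_induct)
  case (step i)
  then have "[i..<Suc k] = i # Suc i # [Suc (Suc i)..<Suc k]" "[Suc i..<Suc k] = Suc i # [Suc (Suc i)..<Suc k]"
    by (simp_all add: upt_rec del: upt_Suc)
  then show ?case
    using step by (simp add: rpoch_def tail_sum_rec prod.atLeast_Suc_lessThan del: upt_Suc)
qed simp

lemma chain_nonzero_imp_tail_sum:
  assumes "chain (xs @ [0]) \<noteq> 0"
  shows "\<exists>m \<in> carrier_vec (length xs). xs @ [0] = map (tail_sum (length xs) m) [0..<Suc (length xs)]"
proof -
  define ys where "ys = xs @ [0]"
  \<comment> \<open>These differences are exact in \<open>nat\<close>, since a nonzero chain is
    weakly decreasing.\<close>
  define m where "m = vec (length xs) (\<lambda>i. ys ! i - ys ! Suc i)"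
  have decr: "chain ys \<noteq> 0 \<Longrightarrow> Suc i < length ys \<Longrightarrow> ys ! Suc i \<le> ys ! i" for ys i
  proof (induction ys arbitrary: i rule: chain.induct)
    case (1 x y ys)
    then show ?case
      by (cases i) (auto simp: rpoch_def split: if_splits)
  qed auto
  have "tail_sum (length xs) m i = ys ! i" if "i \<le> length xs" for i
    using that
  proof (induction i rule: inc_induct)
    case base
    then show ?case by (simp add: ys_def)
  next
    case (step i)
    then show ?case
      using decr[of ys i] assms by (simp add: tail_sum_rec m_def ys_def)
  qed
  then have "ys = map (tail_sum (length xs) m) [0..<Suc (length xs)]"
    by (intro nth_equalityI) (auto simp: ys_def simp del: upt_Suc)
  then show ?thesis
    unfolding ys_def by (intro bexI[of _ m]) (auto simp: m_def)
qed

lemma tail_sum_inj: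
  assumes "m \<in> carrier_vec k" "m' \<in> carrier_vec k"
    and "map (tail_sum k m) [0..<Suc k] = map (tail_sum k m') [0..<Suc k]"
  shows "m = m'"
proof (rule eq_vecI)
  fix i assume "i < dim_vec m'"
  then have i: "i < k"
    using assms by simp
  have "tail_sum k m j = tail_sum k m' j" if "j \<le> k" for j
    using assms(3) that by (simp del: upt_Suc)
  from this[of i] this[of "Suc i"] i show "m $ i = m' $ i"
    by (simp add: tail_sum_rec)
qed (use assms in auto)

definition size_pairs :: "nat \<Rightarrow> nat \<Rightarrow> (nat vec \<times> nat vec) set" where
  "size_pairs k n = {(m1, m2). m1 \<in> carrier_vec k \<and> m2 \<in> carrier_vec k \<and>
     size_of k m1 + size_of k m2 = n}"

text \<open>Tail sums embed the pairs of vectors into the profiles; a profile outside the image has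
  a vanishing chain.\<close>

lemma word_val_eq_sum_size_pairs:
  "word_val w n = (\<Sum>(m1, m2) \<in> size_pairs (length w) n. profile_wt w (profile (length w) m1 m2) *
     ((\<Prod>j<length w. inverse (q2_poch (m1 $ j))) * (\<Prod>j<length w. inverse (q2_poch (m2 $ j)))))"
proof -
  define k where "k = length w"
  define h where "h = (\<lambda>(m1, m2). profile k m1 m2)"
  let ?F = "\<lambda>ps. profile_wt w ps * chain (map fst ps @ [0]) * chain (rev (map snd ps) @ [0])"
  have inj: "inj_on h (size_pairs k n)"
  proof (rule inj_onI, clarify)
    fix m1 m2 m1' m2'
    assume mem: "(m1, m2) \<in> size_pairs k n" "(m1', m2') \<in> size_pairs k n" and "h (m1, m2) = h (m1', m2')"
    then have "profile k m1 m2 = profile k m1' m2'"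
      by (simp add: h_def)
    then have "map (tail_sum k m1) [0..<Suc k] = map (tail_sum k m1') [0..<Suc k]"
      "map (tail_sum k m2) [0..<Suc k] = map (tail_sum k m2') [0..<Suc k]"
      unfolding map_fst_profile[of k m1 m2, symmetric] map_fst_profile[of k m1' m2', symmetric]
        rev_map_snd_profile[of k m1 m2, symmetric] rev_map_snd_profile[of k m1' m2', symmetric]
      by simp_all
    then show "m1 = m1' \<and> m2 = m2'"
      using mem by (auto simp: size_pairs_def intro: tail_sum_inj)
  qed
  have "ps \<in> h ` size_pairs k n" if ps: "ps \<in> profiles k n" "?F ps \<noteq> 0" for ps
  proof -
    have len: "length ps = k"
      using ps by (simp add: profiles_def)
    obtain m1 where m1: "m1 \<in> carrier_vec k" "map fst ps @ [0] = map (tail_sum k m1) [0..<Suc k]"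
      using chain_nonzero_imp_tail_sum[of "map fst ps"] ps len by auto
    obtain m2 where m2: "m2 \<in> carrier_vec k"
        "rev (map snd ps) @ [0] = map (tail_sum k m2) [0..<Suc k]"
      using chain_nonzero_imp_tail_sum[of "rev (map snd ps)"] ps len by auto
    have "map fst ps = map fst (profile k m1 m2)"
      using m1(2) map_fst_profile[of k m1 m2] by (metis append1_eq_conv)
    moreover have "map snd ps = map snd (profile k m1 m2)"
      using m2(2) rev_map_snd_profile[of k m1 m2] by (metis append1_eq_conv rev_is_rev_conv)
    ultimately have eq: "ps = profile k m1 m2"
      by (metis zip_map_fst_snd)
    then have "(m1, m2) \<in> size_pairs k n"
      using ps m1 m2 by (simp add: size_pairs_def profile_in_profiles)
    then show ?thesis
      using eq by (force simp: h_def)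
  qed
  moreover have "h ` size_pairs k n \<subseteq> profiles k n"
    by (auto simp: h_def size_pairs_def profile_in_profiles)
  ultimately have "(\<Sum>ps \<in> profiles k n. ?F ps) = (\<Sum>ps \<in> h ` size_pairs k n. ?F ps)"
    by (intro sum.mono_neutral_right finite_profiles) blast+
  also have "\<dots> = (\<Sum>x \<in> size_pairs k n. ?F (h x))"
    by (simp add: sum.reindex[OF inj])
  finally show ?thesis
    unfolding word_val_eq k_def[symmetric]
    by (simp add: h_def split_beta map_fst_profile rev_map_snd_profile chain_tail_sum
        atLeast0LessThan mult.assoc del: upt_Suc)
qed

section \<open>The exponent as a sum over colours\<close>

lemma sum_lessThan_add: "(\<Sum>i<k + l. f i) = (\<Sum>i<k. f i) + (\<Sum>i<l. f (k + i))"
  for f :: "nat \<Rightarrow> 'a::comm_monoid_add"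
  by (induction l) (simp_all add: add.assoc)

lemma min_eq_sum:
  assumes "a < k" "b < k"
  shows "min (int (a + 1)) (int (b + 1)) =
    (\<Sum>i<k. (if i \<le> a then 1 else 0) * (if i \<le> b then 1 else 0))"
proof -
  have "(\<Sum>i<k. (if i \<le> a then 1 else 0) * (if i \<le> b then 1 else (0::int))) =
      (\<Sum>i\<in>{..min a b}. 1)"
    using assms by (intro sum.mono_neutral_cong_right) auto
  then show ?thesis
    by simp
qed

text \<open>Both sides count the colours shared by the first \<open>a + 1\<close> and the last
  \<open>b + 1\<close> of \<open>k\<close> colours.\<close>

lemma max_eq_sum:
  assumes "a < k" "b < k"
  shows "max 0 (int (a + 1) + int (b + 1) - int k) =
    (\<Sum>i<k. (if i \<le> a then 1 else 0) * (if k - 1 - i \<le> b then 1 else 0))"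
proof -
  have "(\<Sum>i<k. (if i \<le> a then 1 else 0) * (if k - 1 - i \<le> b then 1 else (0::int))) =
      (\<Sum>i\<in>{k - 1 - b..a}. 1)"
    using assms by (intro sum.mono_neutral_cong_right) auto
  then show ?thesis
    using assms by (simp add: max_def of_nat_diff)
qed

lemma c3_eq_sum:
  assumes "a < k"
  shows "max (int (a + 1) - int b0) 0 = (\<Sum>i<k. (if b0 \<le> i then 1 else 0) * (if i \<le> a then 1 else 0))"
proof -
  have "(\<Sum>i<k. (if b0 \<le> i then 1 else 0) * (if i \<le> a then 1 else (0::int))) = (\<Sum>i\<in>{b0..a}. 1)"
    using assms by (intro sum.mono_neutral_cong_right) auto
  then show ?thesis
    by (simp add: max_def of_nat_diff)
qed

lemma bilinear_sum:
  fixes x y :: "nat \<Rightarrow> int"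
  assumes "\<And>a b. a < k \<Longrightarrow> b < k \<Longrightarrow> C a b = (\<Sum>i<k. f i a * g i b)"
  shows "(\<Sum>a<k. x a * (\<Sum>b<k. C a b * y b)) = (\<Sum>i<k. (\<Sum>a<k. f i a * x a) * (\<Sum>b<k. g i b * y b))"
proof -
  have "(\<Sum>a<k. x a * (\<Sum>b<k. C a b * y b)) = (\<Sum>a<k. \<Sum>b<k. \<Sum>i<k. (f i a * x a) * (g i b * y b))"
    using assms by (simp add: sum_distrib_left sum_distrib_right mult_ac)
  also have "\<dots> = (\<Sum>a<k. \<Sum>i<k. \<Sum>b<k. (f i a * x a) * (g i b * y b))"
    by (rule sum.cong[OF refl]) (rule sum.swap)
  also have "\<dots> = (\<Sum>i<k. \<Sum>a<k. \<Sum>b<k. (f i a * x a) * (g i b * y b))"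
    by (rule sum.swap)
  finally show ?thesis
    by (simp add: sum_product)
qed

lemma int_tail_sum: "int (tail_sum k m i) = (\<Sum>j<k. (if i \<le> j then 1 else 0) * int (m $ j))"
  by (auto simp: tail_sum_eq intro!: sum.cong)

lemma exponent_eq:
  assumes "m1 \<in> carrier_vec k" "m2 \<in> carrier_vec k"
  shows "exponent k b0 m1 m2 = (\<Sum>i<k. 2 * (int (tail_sum k m1 i) ^ 2 - int (tail_sum k m1 i)
    + int (tail_sum k m2 i) ^ 2 - int (tail_sum k m2 i)
    + int (tail_sum k m1 i) * int (tail_sum k m2 (k - 1 - i))
    + (if b0 \<le> i then 1 else 0) * int (tail_sum k m1 i)))"
proof -
  define x where "x j = int (m1 $ j)" for j
  define y where "y j = int (m2 $ j)" for j
  define N where "N i = int (tail_sum k m1 i)" for i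
  define M where "M i = int (tail_sum k m2 i)" for i
  let ?m = "map_vec int (m1 @\<^sub>v m2)"
  let ?max = "\<lambda>a b. max 0 (int (a + 1) + int (b + 1) - int k)"
  let ?min = "\<lambda>a b. min (int (a + 1)) (int (b + 1))"
  have dims: "dim_vec m1 = k" "dim_vec m2 = k"
    using assms by auto
  have m: "?m $ i = x i" "?m $ (k + i) = y i" if "i < k" for i
    using that dims by (auto simp: x_def y_def)
  have A: "A_mat k $$ (i, j) = 2 * ?min i j" "A_mat k $$ (i, k + j) = ?max i j"
    "A_mat k $$ (k + i, j) = ?max i j" "A_mat k $$ (k + i, k + j) = 2 * ?min i j"
    if "i < k" "j < k" for i j
    using that by (auto simp: A_mat_def A2_def B3_def)
  have dimA: "dim_row (A_mat k) = k + k" "dim_col (A_mat k) = k + k"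
    by (auto simp: A_mat_def A2_def)
  have dimc: "dim_vec (c3 k b0) = k + k"
    by (simp add: c3_def)
  have quad: "?m \<bullet> (A_mat k *\<^sub>v ?m) =
      (\<Sum>a<k. x a * ((\<Sum>b<k. 2 * ?min a b * x b) + (\<Sum>b<k. ?max a b * y b))) +
      (\<Sum>a<k. y a * ((\<Sum>b<k. ?max a b * x b) + (\<Sum>b<k. 2 * ?min a b * y b)))"
  proof -
    have "?m \<bullet> (A_mat k *\<^sub>v ?m) =
        (\<Sum>a<k + k. ?m $ a * (\<Sum>b<k + k. A_mat k $$ (a, b) * ?m $ b))"
      using dims dimA by (auto simp: scalar_prod_def atLeast0LessThan intro!: sum.cong)
    also have "\<dots> = (\<Sum>a<k. x a * ((\<Sum>b<k. 2 * ?min a b * x b) + (\<Sum>b<k. ?max a b * y b))) +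
      (\<Sum>a<k. y a * ((\<Sum>b<k. ?max a b * x b) + (\<Sum>b<k. 2 * ?min a b * y b)))"
      unfolding sum_lessThan_add
      by (intro arg_cong2[where f = "(+)"] arg_cong2[where f = "(*)"] sum.cong refl)
        (simp_all add: m A)
    finally show ?thesis .
  qed
  have diag: "vec_of_list (diag_mat (A_mat k)) \<bullet> ?m =
      (\<Sum>a<k. 2 * int (a + 1) * x a) + (\<Sum>a<k. 2 * int (a + 1) * y a)"
  proof -
    have "vec_of_list (diag_mat (A_mat k)) \<bullet> ?m = (\<Sum>i<k + k. A_mat k $$ (i, i) * ?m $ i)"
      using dims dimA
      by (auto simp: scalar_prod_def diag_mat_def vec_of_list_index atLeast0LessThan
          intro!: sum.cong)
    also have "\<dots> = (\<Sum>a<k. 2 * int (a + 1) * x a) + (\<Sum>a<k. 2 * int (a + 1) * y a)"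
      unfolding sum_lessThan_add
      by (intro arg_cong2[where f = "(+)"] sum.cong refl) (simp_all add: m A)
    finally show ?thesis .
  qed
  have lin: "c3 k b0 \<bullet> ?m = (\<Sum>a<k. max (int (a + 1) - int b0) 0 * x a)"
  proof -
    have "c3 k b0 \<bullet> ?m = (\<Sum>i<k + k. c3 k b0 $ i * ?m $ i)"
      using dims by (auto simp: scalar_prod_def atLeast0LessThan)
    also have "\<dots> = (\<Sum>a<k. max (int (a + 1) - int b0) 0 * x a) + (\<Sum>a<k. 0 * y a)"
      unfolding sum_lessThan_add
      by (intro arg_cong2[where f = "(+)"] sum.cong refl) (simp_all add: m c3_def)
    finally show ?thesis
      by simp
  qed
  have N: "N i = (\<Sum>a<k. (if i \<le> a then 1 else 0) * x a)"
    and M: "M i = (\<Sum>a<k. (if i \<le> a then 1 else 0) * y a)" for i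
    by (simp_all add: N_def M_def x_def y_def int_tail_sum)
  have xx: "(\<Sum>a<k. x a * (\<Sum>b<k. ?min a b * x b)) = (\<Sum>i<k. N i * N i)"
    unfolding N by (rule bilinear_sum) (rule min_eq_sum)
  have yy: "(\<Sum>a<k. y a * (\<Sum>b<k. ?min a b * y b)) = (\<Sum>i<k. M i * M i)"
    unfolding M by (rule bilinear_sum) (rule min_eq_sum)
  have xy: "(\<Sum>a<k. x a * (\<Sum>b<k. ?max a b * y b)) = (\<Sum>i<k. N i * M (k - 1 - i))"
    unfolding N M by (rule bilinear_sum) (rule max_eq_sum)
  \<comment> \<open>\<open>?max\<close> is symmetric, so the second mixed block repeats the first;
    hence the factor 2 of the mixed term.\<close>
  have yx: "(\<Sum>a<k. y a * (\<Sum>b<k. ?max a b * x b)) = (\<Sum>i<k. N i * M (k - 1 - i))"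
  proof -
    have "(\<Sum>a<k. y a * (\<Sum>b<k. ?max a b * x b)) = (\<Sum>a<k. \<Sum>b<k. x b * (?max b a * y a))"
      by (simp add: sum_distrib_left mult_ac add_ac)
    also have "\<dots> = (\<Sum>b<k. \<Sum>a<k. x b * (?max b a * y a))"
      by (rule sum.swap)
    finally show ?thesis
      unfolding sum_distrib_left[symmetric] xy .
  qed
  have dx: "(\<Sum>a<k. int (a + 1) * x a) = (\<Sum>i<k. N i)"
    unfolding N_def x_def of_nat_sum[symmetric] sum_tail_sum by (simp add: size_of_eq distrib_right)
  have dy: "(\<Sum>a<k. int (a + 1) * y a) = (\<Sum>i<k. M i)"
    unfolding M_def y_def of_nat_sum[symmetric] sum_tail_sum by (simp add: size_of_eq distrib_right)
  have cx: "(\<Sum>a<k. max (int (a + 1) - int b0) 0 * x a) = (\<Sum>i<k. (if b0 \<le> i then 1 else 0) * N i)"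
  proof -
    have "(\<Sum>a<k. max (int (a + 1) - int b0) 0 * x a) =
        (\<Sum>a<k. \<Sum>i<k. (if b0 \<le> i then 1 else 0) * ((if i \<le> a then 1 else 0) * x a))"
      by (rule sum.cong[OF refl])
        (simp only: lessThan_iff c3_eq_sum[where k = k] sum_distrib_right mult.assoc)
    also have "\<dots> = (\<Sum>i<k. \<Sum>a<k. (if b0 \<le> i then 1 else 0) * ((if i \<le> a then 1 else 0) * x a))"
      by (rule sum.swap)
    finally show ?thesis
      by (simp add: N sum_distrib_left)
  qed
  have "exponent k b0 m1 m2 =
      2 * (\<Sum>a<k. x a * (\<Sum>b<k. ?min a b * x b)) + (\<Sum>a<k. x a * (\<Sum>b<k. ?max a b * y b))
      + (\<Sum>a<k. y a * (\<Sum>b<k. ?max a b * x b)) + 2 * (\<Sum>a<k. y a * (\<Sum>b<k. ?min a b * y b))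
      - 2 * (\<Sum>a<k. int (a + 1) * x a) - 2 * (\<Sum>a<k. int (a + 1) * y a)
      + 2 * (\<Sum>a<k. max (int (a + 1) - int b0) 0 * x a)"
    unfolding exponent_def Let_def quad diag lin
    by (simp add: sum.distrib distrib_left sum_distrib_left mult_ac)
  also have "\<dots> = (\<Sum>i<k. 2 * (N i ^ 2 - N i + M i ^ 2 - M i + N i * M (k - 1 - i)
    + (if b0 \<le> i then 1 else 0) * N i))"
    unfolding xx yy xy yx dx dy cx power2_eq_square
    by (simp only: sum.distrib sum_subtractf sum_distrib_left[symmetric] distrib_left right_diff_distrib)
  finally show ?thesis
    by (simp add: N_def M_def)
qed

lemma prod_list_map_upt: "prod_list (map f [0..<k]) = (\<Prod>i<k. f i)"
  for f :: "nat \<Rightarrow> 'a::comm_monoid_mult"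
  by (induction k) (simp_all add: mult.commute)

lemma profile_wt_fermionic:
  assumes "m1 \<in> carrier_vec k" "m2 \<in> carrier_vec k" "b0 \<le> k"
  shows "profile_wt (replicate b0 (0, 0) @ replicate (k - b0) (1, 0)) (profile k m1 m2) =
    q ^ nat (exponent k b0 m1 m2) * q ^ size_of k m2"
proof -
  define N where "N = tail_sum k m1"
  define M where "M = tail_sum k m2"
  define g where "g i = 2 * (N i * (N i - 1) + M (k - 1 - i) * (M (k - 1 - i) - 1) + N i * M (k - 1 - i)
    + (if b0 \<le> i then 1 else 0) * N i)" for i
  let ?w = "replicate b0 (0, 0) @ replicate (k - b0) (1, 0)"
  \<comment> \<open>The switch to \<open>(1, 0)\<close> at colour \<open>b0\<close> makes
    \<open>s * N\<close> contribute the linear term of \<open>c3\<close>.\<close>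
  have w: "?w = map (\<lambda>i. (if b0 \<le> i then 1 else 0, 0)) [0..<k]"
    using assms(3) by (auto intro!: nth_equalityI simp: nth_append)
  have "profile_wt ?w (profile k m1 m2) = (\<Prod>i<k. q ^ (M (k - 1 - i) + g i))"
    unfolding profile_wt_def w profile_def
    by (simp add: zip_map_map o_def map_zip_map2 zip_same_conv_map N_def M_def g_def
        prod_list_map_upt)
  also have "\<dots> = q ^ ((\<Sum>i<k. M (k - 1 - i)) + (\<Sum>i<k. g i))"
    by (simp only: power_sum flip: sum.distrib)
  also have "(\<Sum>i<k. M (k - 1 - i)) = size_of k m2"
    unfolding M_def by (simp only: sum_rev_lessThan sum_tail_sum)
  also have "(\<Sum>i<k. g i) = nat (exponent k b0 m1 m2)"
  proof -
    have sq: "int (n * (n - 1)) = int n ^ 2 - int n" for n :: nat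
      by (cases n) (simp_all add: power2_eq_square algebra_simps)
    have "int (\<Sum>i<k. g i) = (\<Sum>i<k. 2 * (int (N i) ^ 2 - int (N i)
        + int (N i) * int (M (k - 1 - i)) + (if b0 \<le> i then 1 else 0) * int (N i)))
        + (\<Sum>i<k. 2 * (int (M (k - 1 - i)) ^ 2 - int (M (k - 1 - i))))"
      unfolding of_nat_sum sum.distrib[symmetric] g_def
      by (intro sum.cong refl) (simp only: of_nat_mult[of 2] of_nat_add sq of_nat_mult[of "N _" "M _"], simp)
    also have "(\<Sum>i<k. 2 * (int (M (k - 1 - i)) ^ 2 - int (M (k - 1 - i)))) =
        (\<Sum>i<k. 2 * (int (M i) ^ 2 - int (M i)))"
      by (rule sum_rev_lessThan[of "\<lambda>i. 2 * (int (M i) ^ 2 - int (M i))"])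
    finally have "int (\<Sum>i<k. g i) = exponent k b0 m1 m2"
      unfolding exponent_eq[OF assms(1,2)] sum.distrib[symmetric] N_def M_def
      by (simp add: algebra_simps)
    then show ?thesis
      by (metis nat_int)
  qed
  finally show ?thesis
    by (simp add: power_add mult.commute)
qed

lemma fermionic_summand:
  assumes "m1 \<in> carrier_vec k" "m2 \<in> carrier_vec k" "b0 \<le> k"
  shows "q ^ nat (exponent k b0 m1 m2)
      / ((\<Prod>j=1..k. q2_poch (m1 $ (j - 1))) * (\<Prod>j=1..k. q2_poch (m2 $ (j - 1)))) * q ^ size_of k m2 =
    profile_wt (replicate b0 (0, 0) @ replicate (k - b0) (1, 0)) (profile k m1 m2) *
      ((\<Prod>j<k. inverse (q2_poch (m1 $ j))) * (\<Prod>j<k. inverse (q2_poch (m2 $ j))))"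
proof -
  have shift: "(\<Prod>j=1..k. q2_poch (m $ (j - 1))) = (\<Prod>j<k. q2_poch (m $ j))" for m
    by (rule prod.reindex_bij_witness[where i = Suc and j = "\<lambda>j. j - 1"]) auto
  have nth_0: "fps_nth (\<Prod>j<k. q2_poch (m $ j)) 0 = 1" for m and k :: nat
    by (induction k) (simp_all add: q2_poch_nth_0)
  have inv: "inverse (\<Prod>j<k. q2_poch (m $ j)) = (\<Prod>j<k. inverse (q2_poch (m $ j)))" for m and k :: nat
    by (induction k) (simp_all add: fps_inverse_mult)
  show ?thesis
    unfolding shift profile_wt_fermionic[OF assms]
    by (subst fps_divide_unit) (simp_all add: nth_0 fps_inverse_mult inv mult_ac)
qed

theorem theorem8p8:
  fixes k b0 :: nat
  assumes "1 \<le> k" and "b0 \<le> k"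
  shows "(\<lambda>n. fps_const
            (\<Sum>(l1, l2) | l1 + l2 = n.
               \<Sum>(m1, m2) \<in> multiplicities k l1 \<times> multiplicities k l2.
                 q ^ nat (exponent k b0 m1 m2)
                   / ((\<Prod>j=1..k. q2_poch (m1 $ (j - 1))) * (\<Prod>j=1..k. q2_poch (m2 $ (j - 1))))
                 * q ^ l2)
            * z ^ n)
         sums chi3 k b0 k"
proof -
  let ?w = "replicate b0 (0, 0) @ replicate (k - b0) (1, 0)"
  have len: "length ?w = k"
    using assms by simp
  have coeff: "(\<Sum>(l1, l2) | l1 + l2 = n.
               \<Sum>(m1, m2) \<in> multiplicities k l1 \<times> multiplicities k l2.
                 q ^ nat (exponent k b0 m1 m2)
                   / ((\<Prod>j=1..k. q2_poch (m1 $ (j - 1))) * (\<Prod>j=1..k. q2_poch (m2 $ (j - 1))))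
                 * q ^ l2) = fps_nth (chi3 k b0 k) n" (is "?lhs = _") for n
  proof -
    let ?f = "\<lambda>m1 m2 l2. q ^ nat (exponent k b0 m1 m2)
      / ((\<Prod>j=1..k. q2_poch (m1 $ (j - 1))) * (\<Prod>j=1..k. q2_poch (m2 $ (j - 1)))) * q ^ l2"
    have "finite {(l1, l2). l1 + l2 = n}"
      by (rule finite_subset[of _ "{..n} \<times> {..n}"]) auto
    then have "?lhs = (\<Sum>((l1, l2), m1, m2) \<in> (SIGMA (l1, l2):{(l1, l2). l1 + l2 = n}.
        multiplicities k l1 \<times> multiplicities k l2). ?f m1 m2 l2)"
      by (subst sum.Sigma[symmetric]) (auto simp: finite_multiplicities split_beta)
    \<comment> \<open>\<open>l1\<close> and \<open>l2\<close> are determined by the two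
      vectors.\<close>
    also have "\<dots> = (\<Sum>(m1, m2) \<in> size_pairs k n. ?f m1 m2 (size_of k m2))"
      by (rule sum.reindex_bij_witness[where j = snd
            and i = "\<lambda>(m1, m2). ((size_of k m1, size_of k m2), m1, m2)"])
        (auto simp: size_pairs_def multiplicities_def size_of_def)
    also have "\<dots> = word_val ?w n"
      unfolding word_val_eq_sum_size_pairs len
      using assms by (intro sum.cong refl) (auto simp: size_pairs_def fermionic_summand simp del: One_nat_def)
    also have "\<dots> = config_char b0 (k - b0) 0 n"
      by (rule config_char_word[symmetric])
    also have "\<dots> = fps_nth (chi3 k b0 k) n"
      using assms by (intro fps_ext) (simp add: config_char_nth chi3_nth configs_def)
    finally show ?thesis .
  qed
  have "(\<lambda>n. fps_const (fps_nth (chi3 k b0 k) n) * z ^ n) sums chi3 k b0 k"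
    using fps_notation[of "chi3 k b0 k"] by (simp add: sums_def_le atMost_atLeast0)
  then show ?thesis
    by (simp only: coeff)
qed

end
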